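(* Let $1\le p<\infty$. Assume that $X$ supports a $1$-Poincaré inequality at $x_0$, that $\mu$ has the $1$-annular decay property at $x_0$, and that $\mu$ is reverse-doubling at $x_0$ with dilation $\tau>1$. Then there is a constant $C\ge1$, independent of $r$ and $R$, such that $$\frac1C\Bigl(1-\frac{r}{R}\Bigr)^{1-p}\frac{\mu(B_R)}{R^p}\le\operatorname{cap}_p(B_r,B_R)\le C\Bigl(1-\frac{r}{R}\Bigr)^{1-p}\frac{\mu(B_R)}{R^p}\qquad\text{whenever } 0<\frac R2\le r<R\le\frac{\operatorname{diam}X}{2\tau}.$$
   Context: $X=(X,d,\mu)$ is a metric space equipped with a metric $d$ and a positive complete Borel measure $\mu$ such that $0<\mu(B)<\infty$ for all balls $B\subset X$. Write $B(x,r)=\{y\in X: d(y,x)<r\}$; $x_0\in X$ is a fixed but arbitrary point and $B_r=B(x_0,r)$. For a ball $B=B(x,r)$ and $\lambda>0$, $\lambda B=B(x,\lambda r)$. Annular decay: $\mu$ has the $1$-annular decay property at $x$ if there is a constant $C$ such that $\mu(B(x,R)\setminus B(x,r))\le C(1-r/R)\mu(B(x,R))$ for all radii $0<r<R$. Reverse-doubling: $\mu$ is reverse-doubling at $x$ with dilation $\tau>1$ if there is $\gamma>1$ such that $\mu(B(x,\tau r))\ge\gamma\mu(B(x,r))$ for all $0<r\le\operatorname{diam}X/(2\tau)$. Upper gradients and Newtonian space: curves are nonconstant, compact and rectifiable, parameterized by arc length $ds$. A Borel function $g:X\to[0,\infty]$ is an upper gradient of $f:X\to[-\infty,\infty]$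 if for all curves $\gamma:[0,l_\gamma]\to X$, $|f(\gamma(0))-f(\gamma(l_\gamma))|\le\int_\gamma g\,ds$, where the left-hand side is considered to be $\infty$ whenever at least one of the terms therein is infinite. A measurable $g:X\to[0,\infty]$ is a $p$-weak upper gradient of $f$ if this inequality holds for $p$-almost every curve, i.e. except for a family $\Gamma$ of curves for which there is $0\le\rho\in L^p(X)$ with $\int_\gamma\rho\,ds=\infty$ for all $\gamma\in\Gamma$. If $f$ has an upper gradient in $L^p(X)$, then $g_f$ denotes its (a.e. unique) minimal $p$-weak upper gradient in $L^p(X)$, i.e. $g_f\le g$ a.e. for every $p$-weak upper gradient $g\in L^p(X)$ of $f$. $N^{1,p}(X)$ is the space of measurable functions $f:X\to[-\infty,\infty]$ (defined everywhere) with $\|f\|_{N^{1,p}(X)}=\bigl(\int_X|f|^p\,d\mu+\inf_g\int_X g^p\,d\mu\bigr)^{1/p}<\infty$, the infimum being over all upper gradients $g$ of $f$. Poincaré inequality: $X$ supports a $1$-Poincaré inequality at $x$ if there are constants $C>0$ and $\lambda\ge1$ such that for all balls $B=B(x,r)$, $r>0$, all integrable functions $f$ on $X$ and all upper gradients $g$ of $f$, $\frac1{\mu(B)}\int_B|f-f_B|\,d\mu\le Cr\,\frac1{\mu(\lambda B)}\int_{\lambda B}g\,d\mu$, where $f_B=\frac1{\mu(B)}\int_Bf\,d\mu$. Variational capacity: for $\Omega\subset X$ open and $E\subset\Omega$, $\operatorname{cap}_p(E,\Omega)=\inf_u\int_\Omega g_u^p\,d\mu$, the infimum being over all $u\in N^{1,p}(X)$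 with $\chi_E\le u\le1$ in $\Omega$ and $u=0$ on $X\setminus\Omega$. *)

theory Defs
  imports "HOL-Analysis.Analysis"
begin

text \<open>
  A ``complete Borel measure'' is the completion of a measure on the Borel \<open>\<sigma>\<close>-algebra. Mere
  completeness together with \<open>sets borel \<subseteq> sets \<mu>\<close> would be too weak: it would admit measures on larger
  \<open>\<sigma>\<close>-algebras, whose measurable functions need not agree almost everywhere with Borel functions.
\<close>

definition complete_borel_measure :: "'a::metric_space measure \<Rightarrow> bool" where
  "complete_borel_measure \<mu> \<longleftrightarrow> (\<exists>\<nu>. sets \<nu> = sets borel \<and> \<mu> = completion \<nu>)"

definition metric_measure_space :: "'a::metric_space measure \<Rightarrow> bool" where
  "metric_measure_space \<mu> \<longleftrightarrow> complete_borel_measure \<mu> \<and>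
     (\<forall>x r. 0 < r \<longrightarrow> 0 < emeasure \<mu> (ball x r) \<and> emeasure \<mu> (ball x r) < \<infinity>)"

text \<open>The library's \<^const>\<open>diameter\<close> is real valued and carries no information on unbounded sets.\<close>

definition ediameter :: "'a::metric_space set \<Rightarrow> ereal" where
  "ediameter S = (SUP (x, y) \<in> S \<times> S. ereal (dist x y))"

definition annular_decay_1 :: "'a::metric_space measure \<Rightarrow> 'a \<Rightarrow> bool" where
  "annular_decay_1 \<mu> x \<longleftrightarrow> (\<exists>C::real. \<forall>r R. 0 < r \<and> r < R \<longrightarrow>
     measure \<mu> (ball x R - ball x r) \<le> C * (1 - r / R) * measure \<mu> (ball x R))"

definition reverse_doubling :: "'a::metric_space measure \<Rightarrow> 'a \<Rightarrow> real \<Rightarrow> bool" where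
  "reverse_doubling \<mu> x \<tau> \<longleftrightarrow> 1 < \<tau> \<and> (\<exists>\<gamma>>1. \<forall>r>0.
     ereal r \<le> ediameter (UNIV :: 'a set) / ereal (2 * \<tau>) \<longrightarrow>
     \<gamma> * measure \<mu> (ball x r) \<le> measure \<mu> (ball x (\<tau> * r)))"

text \<open>The power \<open>x\<^sup>p\<close> on \<open>[0, \<infinity>]\<close>, used for exponents \<open>p > 0\<close> only.\<close>

definition epowr :: "ennreal \<Rightarrow> real \<Rightarrow> ennreal" where
  "epowr x p = (if x = \<infinity> then \<infinity> else ennreal (enn2real x powr p))"

definition curve_length :: "(real \<Rightarrow> 'a::metric_space) \<Rightarrow> real \<Rightarrow> real \<Rightarrow> ennreal" where
  "curve_length c a b = (SUP ts \<in> {ts. sorted ts \<and> set ts \<subseteq> {a..b}}.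
     \<Sum>i<length ts - 1. ennreal (dist (c (ts ! i)) (c (ts ! Suc i))))"

text \<open>
  A curve is a pair \<open>(c, l)\<close>, of which only the restriction of \<open>c\<close> to \<open>{0..l}\<close> matters. The condition
  on lengths says that \<open>c\<close> is rectifiable and parameterized by arc length; then \<open>l\<close> is the length of
  the curve, and \<open>0 < l\<close> says that it is nonconstant.
\<close>

definition arc_length_curve :: "(real \<Rightarrow> 'a::metric_space) \<Rightarrow> real \<Rightarrow> bool" where
  "arc_length_curve c l \<longleftrightarrow> 0 < l \<and> continuous_on {0..l} c \<and>
     (\<forall>t\<in>{0..l}. curve_length c 0 t = ennreal t)"

text \<open>
  For \<^const>\<open>lebesgue\<close>-measurable \<open>g \<circ> c\<close> this is the usual integral. For \<open>\<mu>\<close>-measurable \<open>g\<close> with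
  \<open>\<mu>\<close> as above, \<open>g \<circ> c\<close> is measurable for \<open>p\<close>-almost every curve.
\<close>

definition line_integral :: "(real \<Rightarrow> 'a::metric_space) \<Rightarrow> real \<Rightarrow> ('a \<Rightarrow> ennreal) \<Rightarrow> ennreal" where
  "line_integral c l g = (\<integral>\<^sup>+t\<in>{0..l}. g (c t) \<partial>lebesgue)"

definition upper_gradient_ineq ::
  "('a::metric_space \<Rightarrow> ereal) \<Rightarrow> ('a \<Rightarrow> ennreal) \<Rightarrow> (real \<Rightarrow> 'a) \<Rightarrow> real \<Rightarrow> bool" where
  "upper_gradient_ineq f g c l \<longleftrightarrow>
     (if \<bar>f (c 0)\<bar> = \<infinity> \<or> \<bar>f (c l)\<bar> = \<infinity> then \<infinity> else e2ennreal \<bar>f (c 0) - f (c l)\<bar>)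
       \<le> line_integral c l g"

definition upper_gradient :: "('a::metric_space \<Rightarrow> ereal) \<Rightarrow> ('a \<Rightarrow> ennreal) \<Rightarrow> bool" where
  "upper_gradient f g \<longleftrightarrow> g \<in> borel_measurable borel \<and>
     (\<forall>c l. arc_length_curve c l \<longrightarrow> upper_gradient_ineq f g c l)"

text \<open>Membership in \<open>L\<^sup>p(X)\<close> for nonnegative functions.\<close>

definition Lp_nonneg :: "'a measure \<Rightarrow> real \<Rightarrow> ('a \<Rightarrow> ennreal) \<Rightarrow> bool" where
  "Lp_nonneg \<mu> p g \<longleftrightarrow> g \<in> borel_measurable \<mu> \<and> (\<integral>\<^sup>+x. epowr (g x) p \<partial>\<mu>) < \<infinity>"

definition exceptional_family ::
  "'a::metric_space measure \<Rightarrow> real \<Rightarrow> ((real \<Rightarrow> 'a) \<times> real) set \<Rightarrow> bool" where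
  "exceptional_family \<mu> p \<Gamma> \<longleftrightarrow>
     (\<exists>\<rho>. Lp_nonneg \<mu> p \<rho> \<and> (\<forall>(c, l) \<in> \<Gamma>. line_integral c l \<rho> = \<infinity>))"

definition weak_upper_gradient ::
  "'a::metric_space measure \<Rightarrow> real \<Rightarrow> ('a \<Rightarrow> ereal) \<Rightarrow> ('a \<Rightarrow> ennreal) \<Rightarrow> bool" where
  "weak_upper_gradient \<mu> p f g \<longleftrightarrow> g \<in> borel_measurable \<mu> \<and>
     exceptional_family \<mu> p {(c, l). arc_length_curve c l \<and> \<not> upper_gradient_ineq f g c l}"

text \<open>\<open>g\<close> is (a representative of) the minimal \<open>p\<close>-weak upper gradient \<open>g\<^sub>f\<close>.\<close>

definition minimal_weak_upper_gradient ::
  "'a::metric_space measure \<Rightarrow> real \<Rightarrow> ('a \<Rightarrow> ereal) \<Rightarrow> ('a \<Rightarrow> ennreal) \<Rightarrow> bool" where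
  "minimal_weak_upper_gradient \<mu> p f g \<longleftrightarrow>
     weak_upper_gradient \<mu> p f g \<and> Lp_nonneg \<mu> p g \<and>
     (\<forall>h. weak_upper_gradient \<mu> p f h \<and> Lp_nonneg \<mu> p h \<longrightarrow> (AE x in \<mu>. g x \<le> h x))"

definition newtonian_norm :: "'a::metric_space measure \<Rightarrow> real \<Rightarrow> ('a \<Rightarrow> ereal) \<Rightarrow> ennreal" where
  "newtonian_norm \<mu> p f =
     epowr ((\<integral>\<^sup>+x. epowr (e2ennreal \<bar>f x\<bar>) p \<partial>\<mu>)
            + (INF g \<in> {g. upper_gradient f g}. \<integral>\<^sup>+x. epowr (g x) p \<partial>\<mu>)) (1 / p)"

definition newtonian_space :: "'a::metric_space measure \<Rightarrow> real \<Rightarrow> ('a \<Rightarrow> ereal) set" where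
  "newtonian_space \<mu> p = {f \<in> borel_measurable \<mu>. newtonian_norm \<mu> p f < \<infinity>}"

definition ereal_integrable :: "'a measure \<Rightarrow> ('a \<Rightarrow> ereal) \<Rightarrow> bool" where
  "ereal_integrable \<mu> f \<longleftrightarrow> f \<in> borel_measurable \<mu> \<and> (\<integral>\<^sup>+x. e2ennreal \<bar>f x\<bar> \<partial>\<mu>) < \<infinity>"

text \<open>An integrable \<open>f\<close> is finite almost everywhere, so \<^const>\<open>real_of_ereal\<close> does not change its integral.\<close>

definition average :: "'a measure \<Rightarrow> ('a \<Rightarrow> ereal) \<Rightarrow> 'a set \<Rightarrow> real" where
  "average \<mu> f B = (LINT x:B|\<mu>. real_of_ereal (f x)) / measure \<mu> B"

definition poincare_1 :: "'a::metric_space measure \<Rightarrow> 'a \<Rightarrow> bool" where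
  "poincare_1 \<mu> x \<longleftrightarrow> (\<exists>C>0. \<exists>\<Lambda>\<ge>1. \<forall>r>0. \<forall>f g.
     ereal_integrable \<mu> f \<and> upper_gradient f g \<longrightarrow>
     (\<integral>\<^sup>+y\<in>ball x r. e2ennreal \<bar>f y - ereal (average \<mu> f (ball x r))\<bar> \<partial>\<mu>) / emeasure \<mu> (ball x r)
       \<le> ennreal (C * r) *
          ((\<integral>\<^sup>+y\<in>ball x (\<Lambda> * r). g y \<partial>\<mu>) / emeasure \<mu> (ball x (\<Lambda> * r))))"

definition cap_admissible ::
  "'a::metric_space measure \<Rightarrow> real \<Rightarrow> 'a set \<Rightarrow> 'a set \<Rightarrow> ('a \<Rightarrow> ereal) \<Rightarrow> bool" where
  "cap_admissible \<mu> p E \<Omega> u \<longleftrightarrow> u \<in> newtonian_space \<mu> p \<and>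
     (\<forall>x\<in>\<Omega>. indicator E x \<le> u x \<and> u x \<le> 1) \<and> (\<forall>x\<in>-\<Omega>. u x = 0)"

text \<open>
  Meant for open \<open>\<Omega>\<close> and \<open>E \<subseteq> \<Omega>\<close>. As \<open>g\<^sub>u\<close> is unique up to null sets, letting \<open>g\<close> range over all its
  representatives does not affect the infimum.
\<close>

definition variational_capacity ::
  "'a::metric_space measure \<Rightarrow> real \<Rightarrow> 'a set \<Rightarrow> 'a set \<Rightarrow> ennreal" where
  "variational_capacity \<mu> p E \<Omega> =
     (INF (u, g) \<in> {(u, g). cap_admissible \<mu> p E \<Omega> u \<and> minimal_weak_upper_gradient \<mu> p u g}.
        \<integral>\<^sup>+x\<in>\<Omega>. epowr (g x) p \<partial>\<mu>)"

end

theory Submission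
  imports Defs
begin

text \<open>
  Upper bound: \<open>u = max 0 (min 1 ((R - d(x\<^sub>0, \<cdot>)) / (R - r)))\<close> has the upper gradient \<open>1 / (R - r)\<close> on
  \<open>B\<^sub>R - B\<^sub>r\<close> and \<open>0\<close> elsewhere, and annular decay bounds the measure of the annulus. As the capacity is
  defined through minimal weak upper gradients, one has to know that \<open>u\<close> has one: weak upper gradients
  are stable under minima and under decreasing limits, so the infimum of a minimizing sequence is one.

  Lower bound: a weak upper gradient of an admissible \<open>u\<close> may be replaced by \<open>0\<close> outside
  \<open>B\<^sub>R - B\<^sub>r\<close>, where \<open>u\<close> is constant. By reverse doubling and the doubling property at \<open>x\<^sub>0\<close>, which
  follows from annular decay, \<open>u\<close> oscillates on \<open>B(x\<^sub>0, \<tau>R)\<close> by a fixed proportion of \<open>\<mu>(B\<^sub>R)\<close>, hence the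
  Poincare inequality gives \<open>\<mu>(B\<^sub>R) / R \<lesssim> \<integral> g\<close> over the annulus. Passing from \<open>g\<close> to \<open>g\<^sup>p\<close> on a set of
  measure at most \<open>C (1 - r/R) \<mu>(B\<^sub>R)\<close> yields the bound.
\<close>

section \<open>Functions of one variable dominated by integrals\<close>

text \<open>A derivative-free form of the condition that \<open>F\<close> is absolutely continuous
  on \<open>{0..l}\<close> with |F'| at most \<open>h\<close> almost everywhere. Asking for all
  subintervals allows \<open>h\<close> to be cut up and recombined; the finite integral supplies
  majorants for dominated convergence.\<close>

definition dominates :: "(real \<Rightarrow> real) \<Rightarrow> real \<Rightarrow> (real \<Rightarrow> ennreal) \<Rightarrow> bool" where
  "dominates F l h \<longleftrightarrow> h \<in> borel_measurable borel \<and> (\<integral>\<^sup>+t\<in>{0..l}. h t \<partial>lborel) < \<infinity> \<and>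
     (\<forall>a b. 0 \<le> a \<and> a \<le> b \<and> b \<le> l \<longrightarrow> ennreal \<bar>F a - F b\<bar> \<le> (\<integral>\<^sup>+t\<in>{a..b}. h t \<partial>lborel))"

lemma dominatesD:
  assumes "dominates F l h"
  shows "h \<in> borel_measurable borel" "(\<integral>\<^sup>+t\<in>{0..l}. h t \<partial>lborel) < \<infinity>"
    "\<And>a b. 0 \<le> a \<Longrightarrow> a \<le> b \<Longrightarrow> b \<le> l \<Longrightarrow> ennreal \<bar>F a - F b\<bar> \<le> (\<integral>\<^sup>+t\<in>{a..b}. h t \<partial>lborel)"
  using assms by (auto simp: dominates_def)

lemma set_nn_integral_mono_set:
  fixes f :: "'b \<Rightarrow> ennreal"
  assumes "A \<subseteq> B"
  shows "(\<integral>\<^sup>+x\<in>A. f x \<partial>M) \<le> (\<integral>\<^sup>+x\<in>B. f x \<partial>M)"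
  using assms by (intro nn_integral_mono) (auto simp: indicator_def)

lemma dominates_finite_subset:
  assumes "dominates F l h" "A \<subseteq> {0..l}"
  shows "(\<integral>\<^sup>+t\<in>A. h t \<partial>lborel) < \<infinity>"
  using set_nn_integral_mono_set[OF assms(2)] dominatesD(2)[OF assms(1)]
  by (rule le_less_trans)

lemma dominates_glue_atMost:
  assumes "dominates F l h1" "dominates F l h2"
  shows "dominates F l (\<lambda>t. if t \<le> x then h1 t else h2 t)"
proof -
  let ?h = "\<lambda>t. if t \<le> x then h1 t else h2 t"
  note [measurable] = dominatesD(1)[OF assms(1)] dominatesD(1)[OF assms(2)]
  have "(\<integral>\<^sup>+t\<in>{0..l}. ?h t \<partial>lborel) \<le> (\<integral>\<^sup>+t. h1 t * indicator {0..l} t + h2 t * indicator {0..l} t \<partial>lborel)"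
    by (intro nn_integral_mono) (auto simp: indicator_def)
  also have "\<dots> = (\<integral>\<^sup>+t\<in>{0..l}. h1 t \<partial>lborel) + (\<integral>\<^sup>+t\<in>{0..l}. h2 t \<partial>lborel)"
    by (intro nn_integral_add) auto
  also have "\<dots> < \<infinity>"
    using dominatesD(2)[OF assms(1)] dominatesD(2)[OF assms(2)] by (simp add: ennreal_add_less_top)
  finally have fin: "(\<integral>\<^sup>+t\<in>{0..l}. ?h t \<partial>lborel) < \<infinity>" .
  have "ennreal \<bar>F a - F b\<bar> \<le> (\<integral>\<^sup>+t\<in>{a..b}. ?h t \<partial>lborel)" if ab: "0 \<le> a" "a \<le> b" "b \<le> l" for a b
  proof -
    \<comment> \<open>The gluing point \<open>x\<close>, clamped to \<open>{a..b}\<close>, so that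
      the cases with \<open>x\<close> outside the interval need no separate treatment.\<close>
    define m where "m = max a (min b x)"
    have m: "a \<le> m" "m \<le> b" using ab by (auto simp: m_def)
    have "ennreal \<bar>F a - F b\<bar> \<le> ennreal (\<bar>F a - F m\<bar> + \<bar>F m - F b\<bar>)"
      by (intro ennreal_leI) linarith
    also have "\<dots> = ennreal \<bar>F a - F m\<bar> + ennreal \<bar>F m - F b\<bar>"
      by (rule ennreal_plus) auto
    also have "\<dots> \<le> (\<integral>\<^sup>+t\<in>{a..m}. h1 t \<partial>lborel) + (\<integral>\<^sup>+t\<in>{m..b}. h2 t \<partial>lborel)"
      using ab m by (intro add_mono dominatesD(3)[OF assms(1)] dominatesD(3)[OF assms(2)]) auto
    also have "\<dots> = (\<integral>\<^sup>+t. h1 t * indicator {a..m} t + h2 t * indicator {m..b} t \<partial>lborel)"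
      by (intro nn_integral_add[symmetric]) auto
    also have "\<dots> \<le> (\<integral>\<^sup>+t\<in>{a..b}. ?h t \<partial>lborel)"
    proof (rule nn_integral_mono_AE)
      \<comment> \<open>Both indicators are 1 at \<open>m\<close>, so the pointwise inequality may
        fail there; one point is null.\<close>
      show "AE t in lborel. h1 t * indicator {a..m} t + h2 t * indicator {m..b} t \<le> ?h t * indicator {a..b} t"
        using AE_lborel_singleton[of m] AE_lborel_singleton[of a]
        by eventually_elim (use ab in \<open>auto simp: indicator_def m_def max_def min_def split: if_splits\<close>)
    qed
    finally show ?thesis .
  qed
  with fin show ?thesis by (auto simp: dominates_def)
qed

text \<open>Dominated convergence on each subinterval, with \<open>w\<close> as the integrable
  majorant.\<close>

lemma dominates_limit:
  assumes h: "\<And>n. dominates F l (h n)"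
    and lim: "\<And>t. (\<lambda>n. h n t) \<longlonglongrightarrow> g t"
    and bnd: "\<And>n t. h n t \<le> w t" "w \<in> borel_measurable borel" "(\<integral>\<^sup>+t\<in>{0..l}. w t \<partial>lborel) < \<infinity>"
  shows "dominates F l g"
proof -
  note [measurable] = dominatesD(1)[OF h] bnd(2)
  have [measurable]: "g \<in> borel_measurable borel"
    using lim by (rule borel_measurable_LIMSEQ_order) measurable
  have conv: "(\<lambda>n. \<integral>\<^sup>+t\<in>A. h n t \<partial>lborel) \<longlonglongrightarrow> (\<integral>\<^sup>+t\<in>A. g t \<partial>lborel)"
    if A: "A \<subseteq> {0..l}" and [measurable]: "A \<in> sets borel" for A
  proof (rule nn_integral_dominated_convergence[where w="\<lambda>t. w t * indicator A t"])
    show "(\<integral>\<^sup>+t\<in>A. w t \<partial>lborel) < \<infinity>"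
      using set_nn_integral_mono_set[OF A] bnd(3) by (rule le_less_trans)
    show "AE t in lborel. (\<lambda>n. h n t * indicator A t) \<longlonglongrightarrow> g t * indicator A t"
      using lim by (auto simp: indicator_def)
    show "AE t in lborel. h n t * indicator A t \<le> w t * indicator A t" for n
      using bnd(1) by (auto simp: indicator_def)
  qed auto
  have "(\<integral>\<^sup>+t\<in>{0..l}. g t \<partial>lborel) \<le> (\<integral>\<^sup>+t\<in>{0..l}. w t \<partial>lborel)"
    by (intro nn_integral_mono mult_right_mono LIMSEQ_le_const2[OF lim]) (use bnd(1) in auto)
  moreover have "ennreal \<bar>F a - F b\<bar> \<le> (\<integral>\<^sup>+t\<in>{a..b}. g t \<partial>lborel)"
    if ab: "0 \<le> a" "a \<le> b" "b \<le> l" for a b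
    by (rule LIMSEQ_le_const[OF conv]) (use ab dominatesD(3)[OF h] in auto)
  ultimately show ?thesis
    using bnd(3) by (auto simp: dominates_def intro: le_less_trans)
qed

text \<open>The sets along which two dominating functions can be glued form a \<open>\<sigma>\<close>-algebra.\<close>

lemma dominates_glue:
  assumes "S \<in> sets borel" "dominates F l h1" "dominates F l h2"
  shows "dominates F l (\<lambda>t. if t \<in> S then h1 t else h2 t)"
proof -
  have "S \<in> sigma_sets UNIV (range atMost)"
    using assms(1) unfolding borel_eq_atMost by simp
  from this assms(2,3) show ?thesis
  proof (induction arbitrary: h1 h2 rule: sigma_sets.induct)
    case (Basic S)
    then show ?case using dominates_glue_atMost by auto
  next
    case Empty
    then show ?case by simp
  next
    case (Compl S)
    \<comment> \<open>Passing to the complement exchanges \<open>h1\<close> and \<open>h2\<close>,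
      which is why the induction keeps both arbitrary.\<close>
    have "(\<lambda>t. if t \<in> UNIV - S then h1 t else h2 t) = (\<lambda>t. if t \<in> S then h2 t else h1 t)" by auto
    with Compl show ?case by simp
  next
    case (Union A)
    \<comment> \<open>Gluing along the first \<open>n\<close> sets takes \<open>n\<close>
      applications of the induction hypothesis, each with the previous function in the role of
      \<open>h2\<close>. The limit in \<open>n\<close> has the majorant
      \<open>h1 + h2\<close>.\<close>
    define h where "h n = (\<lambda>t. if t \<in> (\<Union>i<n. A i) then h1 t else h2 t)" for n :: nat
    have h: "dominates F l (h n)" for n
    proof (induction n)
      case 0
      then show ?case using Union.prems by (simp add: h_def)
    next
      case (Suc n)
      have "h (Suc n) = (\<lambda>t. if t \<in> A n then h1 t else h n t)"
        by (auto simp: h_def less_Suc_eq fun_eq_iff)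
      then show ?case using Union.IH[OF Union.prems(1) Suc] by simp
    qed
    note [measurable] = dominatesD(1)[OF Union.prems(1)] dominatesD(1)[OF Union.prems(2)]
    show ?case
    proof (rule dominates_limit[OF h, where w="\<lambda>t. h1 t + h2 t"])
      show "(\<lambda>n. h n t) \<longlonglongrightarrow> (if t \<in> (\<Union>i. A i) then h1 t else h2 t)" for t
      proof (cases "t \<in> (\<Union>i. A i)")
        case True
        then obtain i where "t \<in> A i" by auto
        then have "eventually (\<lambda>n. h n t = h1 t) sequentially"
          by (intro eventually_sequentiallyI[of "Suc i"]) (auto simp: h_def)
        with True show ?thesis by (simp add: tendsto_eventually)
      qed (auto simp: h_def)
      show "h n t \<le> h1 t + h2 t" for n t by (auto simp: h_def)
      have "(\<integral>\<^sup>+t\<in>{0..l}. (h1 t + h2 t) \<partial>lborel)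
          = (\<integral>\<^sup>+t\<in>{0..l}. h1 t \<partial>lborel) + (\<integral>\<^sup>+t\<in>{0..l}. h2 t \<partial>lborel)"
        by (simp add: distrib_right nn_integral_add)
      also have "\<dots> < \<infinity>"
        using dominatesD(2)[OF Union.prems(1)] dominatesD(2)[OF Union.prems(2)]
        by (simp add: ennreal_add_less_top)
      finally show "(\<integral>\<^sup>+t\<in>{0..l}. (h1 t + h2 t) \<partial>lborel) < \<infinity>" .
    qed measurable
  qed
qed

text \<open>The minimum is the gluing along the set where \<open>h1\<close> is at most
  \<open>h2\<close>, which is a general Borel set; this is what gluing along more than intervals is
  for.\<close>

lemma dominates_min:
  assumes "dominates F l h1" "dominates F l h2"
  shows "dominates F l (\<lambda>t. min (h1 t) (h2 t))"
proof -
  note [measurable] = dominatesD(1)[OF assms(1)] dominatesD(1)[OF assms(2)]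
  have "{t. h1 t \<le> h2 t} \<in> sets borel" by measurable
  from dominates_glue[OF this assms] show ?thesis
    by (simp add: min_def)
qed

text \<open>The finite minima \<open>m n\<close> decrease to the infimum, and \<open>h 0\<close> is
  an integrable majorant.\<close>

lemma dominates_INF:
  fixes h :: "nat \<Rightarrow> real \<Rightarrow> ennreal"
  assumes h: "\<And>n. dominates F l (h n)"
  shows "dominates F l (\<lambda>t. INF n. h n t)"
proof -
  define m where "m n t = (INF i\<in>{..n}. h i t)" for n t
  have m: "dominates F l (m n)" for n
  proof (induction n)
    case 0
    then show ?case using h by (simp add: m_def)
  next
    case (Suc n)
    have "m (Suc n) = (\<lambda>t. min (h (Suc n) t) (m n t))"
      by (auto simp: m_def atMost_Suc inf_min fun_eq_iff)
    then show ?case using dominates_min[OF h Suc] by simp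
  qed
  show ?thesis
  proof (rule dominates_limit[OF m])
    show "(\<lambda>n. m n t) \<longlonglongrightarrow> (INF n. h n t)" for t
    proof -
      have "decseq (\<lambda>n. m n t)"
        unfolding m_def by (intro antimonoI INF_superset_mono) auto
      then have "(\<lambda>n. m n t) \<longlonglongrightarrow> (INF n. m n t)" by (rule LIMSEQ_INF)
      moreover have "(INF n. m n t) = (INF n. h n t)"
        unfolding m_def by (intro antisym INF_greatest) (auto intro: INF_lower INF_lower2)
      ultimately show ?thesis by simp
    qed
    show "m n t \<le> h 0 t" for n t unfolding m_def by (rule INF_lower) simp
  qed (use dominatesD(1,2)[OF h] in auto)
qed

text \<open>The integrals of \<open>h\<close> over intervals shrinking to a point tend to 0, since
  finiteness permits exchanging infimum and integral. Continuity is what makes the level sets in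
  \<open>dominates_restrict\<close> closed.\<close>

lemma dominates_continuous:
  assumes h: "dominates F l h"
  shows "continuous_on {0..l} F"
proof -
  note [measurable] = dominatesD(1)[OF h]
  have "\<exists>d>0. \<forall>x'\<in>{0..l}. dist x' x < d \<longrightarrow> dist (F x') (F x) < e"
    if x: "x \<in> {0..l}" and e: "e > 0" for x e
  proof -
    define A where "A n = {x - 1 / real (Suc n)..x + 1 / real (Suc n)} \<inter> {0..l}" for n
    have [measurable]: "A n \<in> sets borel" for n by (simp add: A_def)
    have fin: "(\<integral>\<^sup>+t\<in>A n. h t \<partial>lborel) < \<infinity>" for n
      by (rule dominates_finite_subset[OF h]) (auto simp: A_def)
    have inc: "A (Suc n) \<subseteq> A n" for n
    proof -
      have "1 / real (Suc (Suc n)) \<le> 1 / real (Suc n)" by (simp add: field_simps)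
      then show ?thesis unfolding A_def by auto
    qed
    have "(\<integral>\<^sup>+t. (INF n. h t * indicator (A n) t) \<partial>lborel) = (INF n. \<integral>\<^sup>+t\<in>A n. h t \<partial>lborel)"
    proof (rule nn_integral_monotone_convergence_INF_decseq[OF _ _ fin])
      show "decseq (\<lambda>n t. h t * indicator (A n) t)"
        using inc by (intro decseq_SucI) (auto simp: le_fun_def indicator_def)
    qed measurable
    moreover have "(\<integral>\<^sup>+t. (INF n. h t * indicator (A n) t) \<partial>lborel) = (\<integral>\<^sup>+(t::real). 0 \<partial>lborel)"
    proof (rule nn_integral_cong_AE)
      \<comment> \<open>Every \<open>t\<close> other than \<open>x\<close> eventually leaves
        \<open>A n\<close>; at \<open>x\<close> itself \<open>h\<close> may be positive, but one
        point is null.\<close>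
      show "AE t in lborel. (INF n. h t * indicator (A n) t) = 0"
        using AE_lborel_singleton[of x]
      proof eventually_elim
        case (elim t)
        then obtain n where n: "1 / real (Suc n) < \<bar>t - x\<bar>"
          using reals_Archimedean[of "\<bar>t - x\<bar>"] by (auto simp: inverse_eq_divide)
        then have "t \<notin> A n" by (auto simp: A_def)
        then have "(INF n. h t * indicator (A n) t) \<le> 0"
          by (intro INF_lower2[of n]) auto
        then show ?case by simp
      qed
    qed
    ultimately have "(INF n. \<integral>\<^sup>+t\<in>A n. h t \<partial>lborel) < ennreal e"
      using e by simp
    then obtain n where n: "(\<integral>\<^sup>+t\<in>A n. h t \<partial>lborel) < ennreal e"
      unfolding INF_less_iff by auto
    have "dist (F x') (F x) < e" if x': "x' \<in> {0..l}" "dist x' x < 1 / real (Suc n)" for x'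
    proof -
      have "{min x x'..max x x'} \<subseteq> A n"
        using x x' by (auto simp: A_def dist_real_def)
      then have "(\<integral>\<^sup>+t\<in>{min x x'..max x x'}. h t \<partial>lborel) \<le> (\<integral>\<^sup>+t\<in>A n. h t \<partial>lborel)"
        by (rule set_nn_integral_mono_set)
      moreover have "ennreal \<bar>F (min x x') - F (max x x')\<bar> \<le> (\<integral>\<^sup>+t\<in>{min x x'..max x x'}. h t \<partial>lborel)"
        using x x' by (intro dominatesD(3)[OF h]) auto
      moreover have "\<bar>F (min x x') - F (max x x')\<bar> = dist (F x') (F x)"
        by (auto simp: dist_real_def min_def max_def)
      ultimately have "ennreal (dist (F x') (F x)) < ennreal e"
        using n by simp
      then show ?thesis by (simp add: ennreal_less_iff)
    qed
    then show ?thesis by (intro exI[of _ "1 / real (Suc n)"]) simp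
  qed
  then show ?thesis unfolding continuous_on_iff by blast
qed

text \<open>On every interval the level set \<open>F = k\<close> is compact, and only what happens before its first
  and after its last point matters.\<close>

lemma dominates_restrict:
  assumes h: "dominates F l h" and S[measurable]: "S \<in> sets borel"
    and k: "\<And>t. t \<in> {0..l} \<Longrightarrow> t \<notin> S \<Longrightarrow> F t = k"
  shows "dominates F l (\<lambda>t. h t * indicator S t)"
proof -
  note [measurable] = dominatesD(1)[OF h]
  have "(\<integral>\<^sup>+t\<in>{0..l}. h t * indicator S t \<partial>lborel) \<le> (\<integral>\<^sup>+t\<in>{0..l}. h t \<partial>lborel)"
    by (intro nn_integral_mono) (auto simp: indicator_def)
  moreover have "ennreal \<bar>F a - F b\<bar> \<le> (\<integral>\<^sup>+t\<in>{a..b}. h t * indicator S t \<partial>lborel)"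
    if ab: "0 \<le> a" "a \<le> b" "b \<le> l" for a b
  proof -
    define K where "K = {t \<in> {a..b}. F t = k}"
    show ?thesis
    proof (cases "K = {}")
      case True
      \<comment> \<open>If \<open>F\<close> never equals \<open>k\<close> on \<open>{a..b}\<close>,
        the whole interval lies in \<open>S\<close> and nothing is cut off.\<close>
      then have "(\<integral>\<^sup>+t\<in>{a..b}. h t \<partial>lborel) \<le> (\<integral>\<^sup>+t\<in>{a..b}. h t * indicator S t \<partial>lborel)"
        using k ab by (intro nn_integral_mono) (auto simp: indicator_def K_def)
      then show ?thesis using dominatesD(3)[OF h ab] by simp
    next
      case False
      have "continuous_on {a..b} F"
        using dominates_continuous[OF h] by (rule continuous_on_subset) (use ab in auto)
      then have "closed K" unfolding K_def
        by (intro continuous_closed_preimage_constant) auto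
      moreover have "bounded K" by (rule bounded_subset[of "{a..b}"]) (auto simp: K_def)
      ultimately have "compact K" by (simp add: compact_eq_bounded_closed)
      obtain s where s: "s \<in> K" "\<And>t. t \<in> K \<Longrightarrow> s \<le> t"
        using compact_attains_inf[OF \<open>compact K\<close> False] by blast
      obtain r where r: "r \<in> K" "\<And>t. t \<in> K \<Longrightarrow> t \<le> r"
        using compact_attains_sup[OF \<open>compact K\<close> False] by blast
      have sr: "a \<le> s" "s \<le> r" "r \<le> b" "F s = k" "F r = k"
        using s r by (auto simp: K_def)
      \<comment> \<open>\<open>F\<close> has the same value \<open>k\<close> at \<open>s\<close> and
        \<open>r\<close>, so the stretch between them contributes nothing to the increment.\<close>
      have "ennreal \<bar>F a - F b\<bar> \<le> ennreal (\<bar>F a - F s\<bar> + \<bar>F r - F b\<bar>)"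
        using sr by (intro ennreal_leI) linarith
      also have "\<dots> = ennreal \<bar>F a - F s\<bar> + ennreal \<bar>F r - F b\<bar>"
        by (rule ennreal_plus) auto
      also have "\<dots> \<le> (\<integral>\<^sup>+t\<in>{a..s}. h t \<partial>lborel) + (\<integral>\<^sup>+t\<in>{r..b}. h t \<partial>lborel)"
        using ab sr by (intro add_mono dominatesD(3)[OF h]) auto
      also have "\<dots> = (\<integral>\<^sup>+t. h t * indicator {a..s} t + h t * indicator {r..b} t \<partial>lborel)"
        by (intro nn_integral_add[symmetric]) auto
      also have "\<dots> \<le> (\<integral>\<^sup>+t\<in>{a..b}. h t * indicator S t \<partial>lborel)"
      proof (rule nn_integral_mono_AE)
        show "AE t in lborel. h t * indicator {a..s} t + h t * indicator {r..b} t
            \<le> h t * indicator S t * indicator {a..b} t"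
          using AE_lborel_singleton[of s] AE_lborel_singleton[of r]
        proof eventually_elim
          case (elim t)
          \<comment> \<open>Before \<open>s\<close> and after \<open>r\<close> the value
            \<open>k\<close> is not attained in \<open>{a..b}\<close>, which forces \<open>t\<close>
            into \<open>S\<close>; in the third case the left-hand side is 0.\<close>
          consider "t \<in> {a..<s}" | "t \<in> {r<..b}" | "t \<notin> {a..s}" "t \<notin> {r..b}"
            using elim by fastforce
          then show ?case
          proof cases
            case 1
            then have "t \<notin> K" using s(2)[of t] by auto
            then have "t \<in> S" using 1 k[of t] ab sr by (auto simp: K_def)
            then show ?thesis using 1 sr by (auto simp: indicator_def)
          next
            case 2
            then have "t \<notin> K" using r(2)[of t] by auto
            then have "t \<in> S" using 2 k[of t] ab sr by (auto simp: K_def)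
            then show ?thesis using 2 sr by (auto simp: indicator_def)
          qed auto
        qed
      qed
      finally show ?thesis .
    qed
  qed
  ultimately show ?thesis
    using dominatesD(2)[OF h] by (auto simp: dominates_def intro: le_less_trans)
qed

section \<open>Arc length curves\<close>

lemma sorted_map_mono_fun:
  fixes f :: "real \<Rightarrow> real"
  assumes "sorted ts" "mono f"
  shows "sorted (map f ts)"
  using assms by (auto simp: sorted_iff_nth_mono mono_def)

text \<open>A partition of \<open>{a..b}\<close> is split at \<open>m\<close> by truncating all its points to \<open>{a..m}\<close> and to \<open>{m..b}\<close>.\<close>

lemma curve_length_triangle:
  assumes "a \<le> m" "m \<le> b"
  shows "curve_length c a b \<le> curve_length c a m + curve_length c m b"
proof -
  let ?V = "\<lambda>ts. \<Sum>i<length ts - 1. ennreal (dist (c (ts ! i)) (c (ts ! Suc i)))"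
  have "?V ts \<le> curve_length c a m + curve_length c m b" if ts: "sorted ts" "set ts \<subseteq> {a..b}" for ts
  proof -
    let ?l = "map (min m) ts" and ?r = "map (max m) ts"
    have "ennreal (dist (c (ts ! i)) (c (ts ! Suc i)))
        \<le> ennreal (dist (c (?l ! i)) (c (?l ! Suc i))) + ennreal (dist (c (?r ! i)) (c (?r ! Suc i)))"
      if i: "i < length ts - 1" for i
    proof -
      have le: "ts ! i \<le> ts ! Suc i"
        using ts(1) i by (auto simp: sorted_iff_nth_mono)
      \<comment> \<open>If the two points lie on either side of \<open>m\<close>, the truncated
        pairs run to \<open>m\<close> and from \<open>m\<close>, and the triangle inequality
        applies; otherwise one truncated pair is constant and the other is the original one.\<close>
      then have "dist (c (ts ! i)) (c (ts ! Suc i))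
          \<le> dist (c (?l ! i)) (c (?l ! Suc i)) + dist (c (?r ! i)) (c (?r ! Suc i))"
        using i dist_triangle[of "c (ts ! i)" "c (ts ! Suc i)" "c m"]
        by (auto simp: min_def max_def)
      then show ?thesis
        by (simp flip: ennreal_plus add: ennreal_leI)
    qed
    then have "?V ts \<le> (\<Sum>i<length ts - 1. ennreal (dist (c (?l ! i)) (c (?l ! Suc i)))
        + ennreal (dist (c (?r ! i)) (c (?r ! Suc i))))"
      by (intro sum_mono) auto
    also have "\<dots> = ?V ?l + ?V ?r" by (simp add: sum.distrib)
    also have "\<dots> \<le> curve_length c a m + curve_length c m b"
      unfolding curve_length_def using ts assms
      by (intro add_mono SUP_upper) (auto intro!: sorted_map_mono_fun simp: mono_def)
    finally show ?thesis .
  qed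
  then show ?thesis unfolding curve_length_def[of c a b] by (intro SUP_least) auto
qed

text \<open>Appending \<open>a\<close> and \<open>b\<close> to a partition of \<open>{0..a}\<close>
  gives a partition of \<open>{0..b}\<close>. For curves parameterized by arc length this yields
  that \<open>c\<close> is 1-Lipschitz.\<close>

lemma curve_length_add_dist_le:
  assumes "0 \<le> a" "a \<le> b"
  shows "curve_length c 0 a + ennreal (dist (c a) (c b)) \<le> curve_length c 0 b"
proof -
  let ?V = "\<lambda>ts. \<Sum>i<length ts - 1. ennreal (dist (c (ts ! i)) (c (ts ! Suc i)))"
  have ne: "{ts. sorted ts \<and> set ts \<subseteq> {0..a}} \<noteq> {}" by (auto intro!: exI[of _ "[]"])
  have "?V ts + ennreal (dist (c a) (c b)) \<le> curve_length c 0 b"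
    if ts: "sorted ts" "set ts \<subseteq> {0..a}" for ts
  proof -
    let ?e = "ts @ [a, b]"
    \<comment> \<open>The right-hand sum also contains the step from the last point of
      \<open>ts\<close> to \<open>a\<close>, which is given away; the one remaining summand of
      \<open>?V ?e\<close> is the distance from \<open>c a\<close> to \<open>c b\<close>.\<close>
    have "?V ts \<le> (\<Sum>i<length ts. ennreal (dist (c (?e ! i)) (c (?e ! Suc i))))"
    proof -
      have "?V ts = (\<Sum>i<length ts - 1. ennreal (dist (c (?e ! i)) (c (?e ! Suc i))))"
        by (intro sum.cong) (auto simp: nth_append)
      also have "\<dots> \<le> (\<Sum>i<length ts. ennreal (dist (c (?e ! i)) (c (?e ! Suc i))))"
        by (intro sum_mono2) auto
      finally show ?thesis .
    qed
    then have "?V ts + ennreal (dist (c a) (c b)) \<le> ?V ?e"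
      by (simp add: nth_append add_mono)
    also have "\<dots> \<le> curve_length c 0 b"
      unfolding curve_length_def using ts assms
      by (intro SUP_upper) (force simp: sorted_append)
    finally show ?thesis .
  qed
  then show ?thesis
    unfolding curve_length_def[of c 0 a] ennreal_SUP_add_left[OF ne, symmetric]
    by (intro SUP_least) auto
qed

lemma arc_length_curve_dist_le:
  assumes c: "arc_length_curve c l" and st: "0 \<le> s" "s \<le> t" "t \<le> l"
  shows "dist (c s) (c t) \<le> t - s"
proof -
  have "ennreal s + ennreal (dist (c s) (c t)) \<le> ennreal t"
    using curve_length_add_dist_le[OF st(1,2), of c] c st by (simp add: arc_length_curve_def)
  then have "ennreal (s + dist (c s) (c t)) \<le> ennreal t" using st by simp
  then show ?thesis using st by (simp del: ennreal_plus)
qed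

text \<open>The length is at most \<open>t\<close> because the Lipschitz bound telescopes over a
  partition, and at least \<open>t\<close> because the length over \<open>{0..a + t}\<close> is
  subadditive at \<open>a\<close>. This makes upper gradient inequalities available on subcurves, as
  \<open>dominates\<close> requires.\<close>

lemma arc_length_curve_sub:
  assumes c: "arc_length_curve c l" and ab: "0 \<le> a" "a < b" "b \<le> l"
  shows "arc_length_curve (\<lambda>t. c (a + t)) (b - a)"
proof -
  have "curve_length (\<lambda>t. c (a + t)) 0 t = ennreal t" if t: "t \<in> {0..b - a}" for t
  proof (rule antisym)
    have "(\<Sum>i<length ts - 1. ennreal (dist (c (a + ts ! i)) (c (a + ts ! Suc i)))) \<le> ennreal t"
      if ts: "sorted ts" "set ts \<subseteq> {0..t}" for ts
    proof (cases "ts = []")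
      case False
      have rng: "0 \<le> ts ! i \<and> ts ! i \<le> t" if "i < length ts" for i
        using subsetD[OF ts(2) nth_mem[OF that]] by simp
      have mono: "ts ! i \<le> ts ! Suc i" if "i < length ts - 1" for i
        using ts(1) that by (auto simp: sorted_iff_nth_mono)
      have "(\<Sum>i<length ts - 1. ennreal (dist (c (a + ts ! i)) (c (a + ts ! Suc i))))
          \<le> (\<Sum>i<length ts - 1. ennreal (ts ! Suc i - ts ! i))"
      proof (intro sum_mono ennreal_leI)
        fix i assume i: "i \<in> {..<length ts - 1}"
        then have "0 \<le> ts ! i" "ts ! Suc i \<le> t" "ts ! i \<le> ts ! Suc i"
          using mono[of i] rng[of i] rng[of "Suc i"] by auto
        then have "dist (c (a + ts ! i)) (c (a + ts ! Suc i)) \<le> (a + ts ! Suc i) - (a + ts ! i)"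
          using ab t by (intro arc_length_curve_dist_le[OF c]) auto
        then show "dist (c (a + ts ! i)) (c (a + ts ! Suc i)) \<le> ts ! Suc i - ts ! i" by simp
      qed
      also have "\<dots> = ennreal (\<Sum>i<length ts - 1. ts ! Suc i - ts ! i)"
        using mono by (intro sum_ennreal) auto
      also have "\<dots> = ennreal (ts ! (length ts - 1) - ts ! 0)"
        by (subst sum_lessThan_telescope) simp
      also have "\<dots> \<le> ennreal t"
        using rng[of 0] rng[of "length ts - 1"] False by (intro ennreal_leI) auto
      finally show ?thesis .
    qed simp
    then show "curve_length (\<lambda>t. c (a + t)) 0 t \<le> ennreal t"
      unfolding curve_length_def by (intro SUP_least) auto
  next
    have shift: "curve_length c a (a + t) \<le> curve_length (\<lambda>t. c (a + t)) 0 t"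
      unfolding curve_length_def
    proof (intro SUP_mono)
      fix ts assume ts: "ts \<in> {ts. sorted ts \<and> set ts \<subseteq> {a..a + t}}"
      show "\<exists>ts'\<in>{ts. sorted ts \<and> set ts \<subseteq> {0..t}}.
          (\<Sum>i<length ts - 1. ennreal (dist (c (ts ! i)) (c (ts ! Suc i))))
        \<le> (\<Sum>i<length ts' - 1. ennreal (dist (c (a + ts' ! i)) (c (a + ts' ! Suc i))))"
      proof (rule bexI[of _ "map (\<lambda>x. x - a) ts"])
        show "map (\<lambda>x. x - a) ts \<in> {ts. sorted ts \<and> set ts \<subseteq> {0..t}}"
          using ts by (auto intro!: sorted_map_mono_fun simp: mono_def)
      qed (auto intro!: sum_mono)
    qed
    have "curve_length c 0 (a + t) = ennreal (a + t)"
    proof -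
      have "a + t \<in> {0..l}" using ab t by auto
      then show ?thesis using c unfolding arc_length_curve_def by blast
    qed
    then have "ennreal (a + t) = curve_length c 0 (a + t)" by (rule sym)
    also have "\<dots> \<le> curve_length c 0 a + curve_length c a (a + t)"
      using t ab(1) by (intro curve_length_triangle) auto
    also have "\<dots> \<le> ennreal a + curve_length (\<lambda>t. c (a + t)) 0 t"
      using c ab by (intro add_mono shift) (auto simp: arc_length_curve_def)
    finally have "ennreal a + ennreal t \<le> ennreal a + curve_length (\<lambda>t. c (a + t)) 0 t"
      using ab t by (simp only: ennreal_plus atLeastAtMost_iff)
    then show "ennreal t \<le> curve_length (\<lambda>t. c (a + t)) 0 t"
      by (subst (asm) ennreal_add_left_cancel_le) simp
  qed
  moreover have "continuous_on {0..b - a} (\<lambda>t. c (a + t))"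
  proof (rule continuous_on_compose2[of "{0..l}" c])
    show "continuous_on {0..l} c" using c by (simp add: arc_length_curve_def)
    show "(\<lambda>t. a + t) ` {0..b - a} \<subseteq> {0..l}" using ab by auto
  qed (intro continuous_intros)
  ultimately show ?thesis using ab by (auto simp: arc_length_curve_def)
qed

section \<open>Line integrals and upper gradients along subcurves\<close>

text \<open>Only \<open>c\<close> on \<open>{0..l}\<close> is meaningful; extending it by its end points makes it Borel measurable.\<close>

definition extend_curve :: "(real \<Rightarrow> 'a) \<Rightarrow> real \<Rightarrow> real \<Rightarrow> 'a" where
  "extend_curve c l t = c (max 0 (min l t))"

lemma extend_curve_eq [simp]: "t \<in> {0..l} \<Longrightarrow> extend_curve c l t = c t"
  by (simp add: extend_curve_def)

lemma extend_curve_measurable: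
  assumes "arc_length_curve c l"
  shows "extend_curve c l \<in> borel_measurable borel"
proof -
  have l: "0 < l" and c: "continuous_on {0..l} c"
    using assms by (auto simp: arc_length_curve_def)
  have "continuous_on UNIV (\<lambda>t. c (max 0 (min l t)))"
    by (rule continuous_on_compose2[OF c]) (use l in \<open>auto intro!: continuous_intros\<close>)
  then show ?thesis
    unfolding extend_curve_def[abs_def] by (rule borel_measurable_continuous_onI)
qed

text \<open>\<open>lebesgue\<close> is the completion of \<open>lborel\<close>, and completion
  leaves nonnegative integrals unchanged even for nonmeasurable integrands. The indicator hides
  where \<open>c\<close> and its extension differ.\<close>

lemma line_integral_extend_curve:
  "line_integral c l g = (\<integral>\<^sup>+t\<in>{0..l}. g (extend_curve c l t) \<partial>lborel)"
  unfolding line_integral_def nn_integral_completion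
  by (intro nn_integral_cong) (auto simp: indicator_def)

lemma line_integral_sub:
  assumes c: "arc_length_curve c l" and ab: "0 \<le> a" "a < b" "b \<le> l"
    and g: "g \<in> borel_measurable borel"
  shows "line_integral (\<lambda>t. c (a + t)) (b - a) g = (\<integral>\<^sup>+t\<in>{a..b}. g (extend_curve c l t) \<partial>lborel)"
proof -
  note [measurable] = g extend_curve_measurable[OF c]
  have "(\<integral>\<^sup>+t\<in>{a..b}. g (extend_curve c l t) \<partial>lborel)
      = (\<integral>\<^sup>+t. g (extend_curve c l (a + t)) * indicator {a..b} (a + t) \<partial>lborel)"
    by (subst nn_integral_real_affine[where c=1 and t=a]) auto
  also have "\<dots> = line_integral (\<lambda>t. c (a + t)) (b - a) g"
    unfolding line_integral_def nn_integral_completion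
    using ab by (intro nn_integral_cong) (auto simp: indicator_def)
  finally show ?thesis ..
qed

lemma upper_gradient_ineq_real:
  "upper_gradient_ineq (\<lambda>x. ereal (u x)) g c l \<longleftrightarrow> ennreal \<bar>u (c 0) - u (c l)\<bar> \<le> line_integral c l g"
  by (simp add: upper_gradient_ineq_def)

lemma upper_gradient_ineq_if_dominates:
  assumes "arc_length_curve c l"
    and "dominates (\<lambda>t. u (extend_curve c l t)) l (\<lambda>t. g (extend_curve c l t))"
  shows "upper_gradient_ineq (\<lambda>x. ereal (u x)) g c l"
proof -
  have "0 < l" using assms(1) by (simp add: arc_length_curve_def)
  then show ?thesis
    using dominatesD(3)[OF assms(2), of 0 l]
    by (simp add: upper_gradient_ineq_real line_integral_extend_curve)
qed

text \<open>The passage from curves in the space to functions on an interval. The inequality for the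
  single curve \<open>c\<close> controls only its two end points; the subintervals in
  \<open>dominates\<close> correspond to subcurves.\<close>

lemma dominates_if_subcurves:
  assumes c: "arc_length_curve c l" and g: "g \<in> borel_measurable borel"
    and fin: "line_integral c l g < \<infinity>"
    and sub: "\<And>a b. 0 \<le> a \<Longrightarrow> a < b \<Longrightarrow> b \<le> l \<Longrightarrow>
      upper_gradient_ineq (\<lambda>x. ereal (u x)) g (\<lambda>t. c (a + t)) (b - a)"
  shows "dominates (\<lambda>t. u (extend_curve c l t)) l (\<lambda>t. g (extend_curve c l t))"
proof -
  note [measurable] = g extend_curve_measurable[OF c]
  have "ennreal \<bar>u (extend_curve c l a) - u (extend_curve c l b)\<bar>
      \<le> (\<integral>\<^sup>+t\<in>{a..b}. g (extend_curve c l t) \<partial>lborel)" if ab: "0 \<le> a" "a \<le> b" "b \<le> l" for a b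
  proof (cases "a = b")
    case False
    then show ?thesis
      using sub[of a b] ab line_integral_sub[OF c _ _ _ g, of a b]
      by (simp add: upper_gradient_ineq_real)
  qed simp
  then show ?thesis
    using fin by (auto simp: dominates_def line_integral_extend_curve)
qed

section \<open>Powers on the extended half-line\<close>

lemma epowr_simps [simp]:
  "epowr top p = top" "0 \<le> x \<Longrightarrow> epowr (ennreal x) p = ennreal (x powr p)"
  by (simp_all add: epowr_def)

lemma epowr_0 [simp]: "epowr 0 p = 0"
  using epowr_simps(2)[of 0 p] by simp

lemma epowr_mono:
  assumes "x \<le> y" "0 < p"
  shows "epowr x p \<le> epowr y p"
  using assms by (cases x; cases y) (auto intro!: ennreal_leI powr_mono2 simp: top_unique)

lemma epowr_epowr_inverse:
  assumes "0 < p"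
  shows "epowr (epowr x p) (1 / p) = x" "epowr (epowr x (1 / p)) p = x"
  using assms by (cases x; simp add: powr_powr)+

lemma epowr_mult:
  assumes "0 < a"
  shows "epowr (ennreal a * x) p = ennreal (a powr p) * epowr x p"
  using assms by (cases x) (auto simp: powr_mult ennreal_mult_top simp flip: ennreal_mult)

lemma epowr_less_top_iff [simp]: "epowr x p < top \<longleftrightarrow> x < top"
  by (cases x) auto

lemma epowr_measurable [measurable]: "(\<lambda>x. epowr x p) \<in> borel_measurable borel"
  unfolding epowr_def by measurable

section \<open>Minimal weak upper gradients\<close>

lemma complete_borel_measurable:
  assumes "complete_borel_measure \<mu>" "f \<in> borel_measurable borel"
  shows "f \<in> borel_measurable \<mu>"
  using assms measurable_cong_sets[of _ borel borel borel]
  by (auto simp: complete_borel_measure_def intro!: measurable_completion)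

lemma Lp_nonneg_borel_iff:
  assumes "complete_borel_measure \<mu>" "g \<in> borel_measurable borel"
  shows "Lp_nonneg \<mu> p g \<longleftrightarrow> (\<integral>\<^sup>+x. epowr (g x) p \<partial>\<mu>) < \<infinity>"
  using complete_borel_measurable[OF assms] by (simp add: Lp_nonneg_def)

lemma Lp_nonneg_mono:
  assumes "complete_borel_measure \<mu>" "h \<in> borel_measurable borel" "Lp_nonneg \<mu> p g"
    and "0 < p" "\<And>x. h x \<le> g x"
  shows "Lp_nonneg \<mu> p h"
proof -
  have "(\<integral>\<^sup>+x. epowr (h x) p \<partial>\<mu>) \<le> (\<integral>\<^sup>+x. epowr (g x) p \<partial>\<mu>)"
    using assms by (intro nn_integral_mono epowr_mono)
  then show ?thesis
    using assms(3) unfolding Lp_nonneg_borel_iff[OF assms(1,2)]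
    by (auto simp: Lp_nonneg_def intro: le_less_trans)
qed

text \<open>A Borel function equal to \<open>g\<close> off a Borel null set is raised to
  \<open>top\<close> on that set. Majorizing everywhere, not just almost everywhere, matters because
  a curve may run inside a null set.\<close>

lemma ex_borel_majorant:
  fixes g :: "'a::metric_space \<Rightarrow> ennreal"
  assumes "complete_borel_measure \<mu>" "g \<in> borel_measurable \<mu>"
  obtains g' where "g' \<in> borel_measurable borel" "\<And>x. g x \<le> g' x" "AE x in \<mu>. g' x = g x"
proof -
  obtain \<nu> where \<nu>: "sets \<nu> = sets borel" "\<mu> = completion \<nu>"
    using assms(1) by (auto simp: complete_borel_measure_def)
  obtain f where f: "f \<in> borel_measurable \<nu>" "AE x in \<nu>. g x = f x"
    using completion_ex_borel_measurable assms(2) \<nu>(2) by blast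
  obtain N where N: "N \<in> null_sets \<nu>" "{x \<in> space \<nu>. g x \<noteq> f x} \<subseteq> N"
    using f(2) by (auto elim!: AE_E simp: null_sets_def)
  have sp: "space \<nu> = UNIV" using sets_eq_imp_space_eq[OF \<nu>(1)] by simp
  have fb[measurable]: "f \<in> borel_measurable borel"
    using f(1) measurable_cong_sets[OF \<nu>(1) refl] by blast
  have Nb[measurable]: "N \<in> sets borel" using N(1) \<nu>(1) by auto
  show ?thesis
  proof (rule that[of "\<lambda>x. if x \<in> N then top else f x"])
    show "(\<lambda>x. if x \<in> N then top else f x) \<in> borel_measurable borel" by measurable
    show "g x \<le> (if x \<in> N then top else f x)" for x
    proof -
      have "g x = f x" if "x \<notin> N" using that N(2) sp by blast
      then show ?thesis by simp
    qed
    have "AE x in \<nu>. x \<notin> N" using N(1) by (rule AE_not_in)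
    then have "AE x in \<nu>. (if x \<in> N then top else f x) = g x"
      using f(2) by eventually_elim auto
    then show "AE x in \<mu>. (if x \<in> N then top else f x) = g x"
      unfolding \<nu>(2) by (rule AE_completion)
  qed
qed

lemma line_integral_mono:
  assumes "\<And>x. g x \<le> h x"
  shows "line_integral c l g \<le> line_integral c l h"
  unfolding line_integral_def using assms by (intro nn_integral_mono mult_right_mono) auto

text \<open>Countable unions of exceptional families are exceptional: suitably weighted, the
  functions \<rho> n fit under one function of finite \<open>p\<close>-energy.\<close>

lemma ex_common_exceptional_function:
  fixes \<rho> :: "nat \<Rightarrow> 'a::metric_space \<Rightarrow> ennreal"
  assumes \<mu>: "complete_borel_measure \<mu>" and p: "0 < p"
    and \<rho>: "\<And>n. \<rho> n \<in> borel_measurable borel" "\<And>n. Lp_nonneg \<mu> p (\<rho> n)"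
  obtains \<sigma> where "\<sigma> \<in> borel_measurable borel" "Lp_nonneg \<mu> p \<sigma>"
    "\<And>c l n. arc_length_curve c l \<Longrightarrow> line_integral c l \<sigma> < \<infinity> \<Longrightarrow> line_integral c l (\<rho> n) < \<infinity>"
proof -
  note [measurable] = \<rho>(1) complete_borel_measurable[OF \<mu> \<rho>(1)]
  define I where "I n = enn2real (\<integral>\<^sup>+x. epowr (\<rho> n x) p \<partial>\<mu>)" for n
  have I: "(\<integral>\<^sup>+x. epowr (\<rho> n x) p \<partial>\<mu>) = ennreal (I n)" "0 \<le> I n" for n
    using \<rho>(2)[of n] by (auto simp: I_def Lp_nonneg_def)
  \<comment> \<open>The weights make the weighted energies summable; the 1 in the denominator covers
    \<open>I n = 0\<close>.\<close>
  define e where "e n = (1 / 2) ^ n / (1 + I n)" for n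
  have e: "0 < e n" "e n * I n \<le> (1 / 2) ^ n" for n
  proof -
    have "e n * I n = (1 / 2) ^ n * (I n / (1 + I n))" by (simp add: e_def)
    also have "\<dots> \<le> (1 / 2) ^ n * 1" using I(2)[of n] by (intro mult_left_mono) auto
    finally show "e n * I n \<le> (1 / 2) ^ n" by simp
    show "0 < e n" using I(2)[of n] by (auto simp: e_def intro!: divide_pos_pos add_pos_nonneg)
  qed
  \<comment> \<open>With a supremum instead of a sum, the \<open>p\<close>-th power is bounded by
    the sum of the weighted \<open>p\<close>-th powers, so no Minkowski inequality enters.\<close>
  define \<sigma> where "\<sigma> x = (SUP n. ennreal (e n powr (1 / p)) * \<rho> n x)" for x
  have \<sigma>[measurable]: "\<sigma> \<in> borel_measurable borel"
    unfolding \<sigma>_def by measurable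
  have le: "epowr (\<sigma> x) p \<le> (\<Sum>n. ennreal (e n) * epowr (\<rho> n x) p)" (is "_ \<le> ?S") for x
  proof -
    have "ennreal (e n powr (1 / p)) * \<rho> n x \<le> epowr ?S (1 / p)" for n
    proof -
      have "ennreal (e n powr (1 / p)) * \<rho> n x = epowr (ennreal (e n) * epowr (\<rho> n x) p) (1 / p)"
        using e p by (simp add: epowr_mult epowr_epowr_inverse)
      also have "\<dots> \<le> epowr ?S (1 / p)"
      proof (rule epowr_mono)
        show "ennreal (e n) * epowr (\<rho> n x) p \<le> ?S"
          using sum_le_suminf[of "\<lambda>n. ennreal (e n) * epowr (\<rho> n x) p" "{n}"] by simp
      qed (use p in simp)
      finally show ?thesis .
    qed
    then have "\<sigma> x \<le> epowr ?S (1 / p)" unfolding \<sigma>_def by (rule SUP_least)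
    then have "epowr (\<sigma> x) p \<le> epowr (epowr ?S (1 / p)) p" using p by (rule epowr_mono)
    then show ?thesis using p by (simp add: epowr_epowr_inverse)
  qed
  have "(\<integral>\<^sup>+x. epowr (\<sigma> x) p \<partial>\<mu>) \<le> (\<integral>\<^sup>+x. (\<Sum>n. ennreal (e n) * epowr (\<rho> n x) p) \<partial>\<mu>)"
    using le by (rule nn_integral_mono)
  also have "\<dots> = (\<Sum>n. \<integral>\<^sup>+x. ennreal (e n) * epowr (\<rho> n x) p \<partial>\<mu>)"
    by (rule nn_integral_suminf) measurable
  also have "\<dots> = (\<Sum>n. ennreal (e n * I n))"
    using e I by (simp add: nn_integral_cmult ennreal_mult less_imp_le)
  also have "\<dots> \<le> (\<Sum>n. ennreal ((1 / 2) ^ n))"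
    using e(2) by (intro suminf_le ennreal_leI) auto
  also have "\<dots> = ennreal (\<Sum>n. (1 / 2) ^ n)"
    by (rule suminf_ennreal2) (auto intro: summable_geometric)
  also have "\<dots> < \<infinity>" by simp
  finally have "Lp_nonneg \<mu> p \<sigma>" by (simp add: Lp_nonneg_borel_iff[OF \<mu> \<sigma>])
  moreover have "line_integral c l (\<rho> n) < \<infinity>"
    if c: "arc_length_curve c l" and fin: "line_integral c l \<sigma> < \<infinity>" for c l n
  proof -
    note [measurable] = extend_curve_measurable[OF c]
    have pos: "0 < e n powr (1 / p)" using e(1)[of n] by simp
    have "ennreal (e n powr (1 / p)) * line_integral c l (\<rho> n)
        = line_integral c l (\<lambda>x. ennreal (e n powr (1 / p)) * \<rho> n x)"
      unfolding line_integral_extend_curve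
      by (subst nn_integral_cmult[symmetric]) (auto simp: mult.assoc)
    also have "\<dots> \<le> line_integral c l \<sigma>"
      by (rule line_integral_mono) (auto simp: \<sigma>_def intro: SUP_upper)
    also have "\<dots> < \<infinity>" by (rule fin)
    finally show ?thesis using pos by (auto simp: ennreal_mult_less_top)
  qed
  ultimately show ?thesis using that \<sigma> by blast
qed

text \<open>
  A Borel representative of a weak upper gradient: off an exceptional family, the inequality holds
  on all subcurves and \<open>g\<close> is integrable along the curve.
\<close>

definition curvewise_gradient ::
  "'a::metric_space measure \<Rightarrow> real \<Rightarrow> ('a \<Rightarrow> real) \<Rightarrow> ('a \<Rightarrow> ennreal) \<Rightarrow> bool" where
  "curvewise_gradient \<mu> p u g \<longleftrightarrow> g \<in> borel_measurable borel \<and> Lp_nonneg \<mu> p g \<and>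
     (\<exists>\<rho>. \<rho> \<in> borel_measurable borel \<and> Lp_nonneg \<mu> p \<rho> \<and>
       (\<forall>c l. arc_length_curve c l \<and> line_integral c l \<rho> < \<infinity> \<longrightarrow>
         dominates (\<lambda>t. u (extend_curve c l t)) l (\<lambda>t. g (extend_curve c l t))))"

lemma curvewise_gradientE:
  assumes "curvewise_gradient \<mu> p u g"
  obtains \<rho> where "\<rho> \<in> borel_measurable borel" "Lp_nonneg \<mu> p \<rho>"
    "\<And>c l. arc_length_curve c l \<Longrightarrow> line_integral c l \<rho> < \<infinity> \<Longrightarrow>
      dominates (\<lambda>t. u (extend_curve c l t)) l (\<lambda>t. g (extend_curve c l t))"
  using assms unfolding curvewise_gradient_def by blast

text \<open>One common exceptional function makes all \<open>g n\<close> dominate along the same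
  curves, where the one-variable result \<open>dominates_INF\<close> applies.\<close>

lemma curvewise_gradient_INF:
  fixes g :: "nat \<Rightarrow> 'a::metric_space \<Rightarrow> ennreal"
  assumes \<mu>: "complete_borel_measure \<mu>" and p: "0 < p"
    and g: "\<And>n. curvewise_gradient \<mu> p u (g n)"
  shows "curvewise_gradient \<mu> p u (\<lambda>x. INF n. g n x)"
proof -
  have gb[measurable]: "g n \<in> borel_measurable borel" and gL: "Lp_nonneg \<mu> p (g n)" for n
    using g by (auto simp: curvewise_gradient_def)
  have "\<forall>n. \<exists>\<rho>. \<rho> \<in> borel_measurable borel \<and> Lp_nonneg \<mu> p \<rho> \<and>
      (\<forall>c l. arc_length_curve c l \<and> line_integral c l \<rho> < \<infinity> \<longrightarrow>
         dominates (\<lambda>t. u (extend_curve c l t)) l (\<lambda>t. g n (extend_curve c l t)))"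
    using g by (auto simp: curvewise_gradient_def)
  from choice[OF this] obtain \<rho> where
    \<rho>: "\<And>n. \<rho> n \<in> borel_measurable borel" "\<And>n. Lp_nonneg \<mu> p (\<rho> n)"
    and dom: "\<And>c l n. arc_length_curve c l \<Longrightarrow> line_integral c l (\<rho> n) < \<infinity> \<Longrightarrow>
         dominates (\<lambda>t. u (extend_curve c l t)) l (\<lambda>t. g n (extend_curve c l t))"
    by blast
  obtain \<sigma> where \<sigma>: "\<sigma> \<in> borel_measurable borel" "Lp_nonneg \<mu> p \<sigma>"
    and fin: "\<And>c l n. arc_length_curve c l \<Longrightarrow> line_integral c l \<sigma> < \<infinity> \<Longrightarrow> line_integral c l (\<rho> n) < \<infinity>"
    by (rule ex_common_exceptional_function[OF \<mu> p \<rho>]) (rule that)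
  have m: "(\<lambda>x. INF n. g n x) \<in> borel_measurable borel" by measurable
  have "Lp_nonneg \<mu> p (\<lambda>x. INF n. g n x)"
    by (rule Lp_nonneg_mono[OF \<mu> m gL[of 0] p]) (auto intro: INF_lower)
  then show ?thesis
    unfolding curvewise_gradient_def using m \<sigma> dominates_INF[OF dom[OF _ fin]]
    by (intro conjI exI[of _ \<sigma>]) auto
qed

lemma curvewise_gradient_min:
  assumes "complete_borel_measure \<mu>" "0 < p"
    and "curvewise_gradient \<mu> p u g" "curvewise_gradient \<mu> p u h"
  shows "curvewise_gradient \<mu> p u (\<lambda>x. min (g x) (h x))"
proof -
  \<comment> \<open>The minimum as the infimum of the sequence \<open>g\<close>, \<open>h\<close>,
    \<open>h\<close>, and so on.\<close>
  define k where "k n x = (if n = 0 then g x else h x)" for n :: nat and x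
  have k: "k 0 = g" "k 1 = h" "\<And>n. k n = g \<or> k n = h" by (auto simp: k_def fun_eq_iff)
  have "(INF n. k n x) = min (g x) (h x)" for x
  proof (rule antisym)
    show "(INF n. k n x) \<le> min (g x) (h x)"
      using INF_lower[of 0 UNIV "\<lambda>n. k n x"] INF_lower[of 1 UNIV "\<lambda>n. k n x"] by (simp only: k UNIV_I min.bounded_iff simp_thms)
    show "min (g x) (h x) \<le> (INF n. k n x)"
      by (rule INF_greatest) (simp add: k_def)
  qed
  moreover have "curvewise_gradient \<mu> p u (k n)" for n using k(3)[of n] assms(3,4) by auto
  ultimately show ?thesis
    using curvewise_gradient_INF[OF assms(1,2), of u k] by simp
qed

lemma curvewise_gradient_imp_weak_upper_gradient:
  assumes \<mu>: "complete_borel_measure \<mu>" and g: "curvewise_gradient \<mu> p u g"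
  shows "weak_upper_gradient \<mu> p (\<lambda>x. ereal (u x)) g"
proof -
  have gm: "g \<in> borel_measurable \<mu>"
    using g complete_borel_measurable[OF \<mu>] by (auto simp: curvewise_gradient_def)
  obtain \<rho> where \<rho>: "Lp_nonneg \<mu> p \<rho>"
    "\<And>c l. arc_length_curve c l \<Longrightarrow> line_integral c l \<rho> < \<infinity> \<Longrightarrow>
      dominates (\<lambda>t. u (extend_curve c l t)) l (\<lambda>t. g (extend_curve c l t))"
    using curvewise_gradientE[OF g] by metis
  have "line_integral c l \<rho> = \<infinity>"
    if c: "arc_length_curve c l" and n: "\<not> upper_gradient_ineq (\<lambda>x. ereal (u x)) g c l" for c l
  proof (rule ccontr)
    assume "line_integral c l \<rho> \<noteq> \<infinity>"
    then have "line_integral c l \<rho> < \<infinity>" by (simp add: less_top)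
    then show False using upper_gradient_ineq_if_dominates[OF c \<rho>(2)[OF c]] n by blast
  qed
  then show ?thesis
    using gm \<rho>(1) by (auto simp: weak_upper_gradient_def exceptional_family_def)
qed

text \<open>Both \<open>g\<close> and the function witnessing the exceptional family are replaced by
  Borel majorants. Finiteness of the line integral of \<rho> passes to subcurves, so off the family
  controlled by \<sigma> no subcurve is exceptional.\<close>

lemma ex_curvewise_gradient:
  assumes \<mu>: "complete_borel_measure \<mu>" and p: "0 < p"
    and g: "weak_upper_gradient \<mu> p (\<lambda>x. ereal (u x)) g" "Lp_nonneg \<mu> p g"
  obtains g' where "curvewise_gradient \<mu> p u g'" "AE x in \<mu>. g' x = g x"
proof -
  have "g \<in> borel_measurable \<mu>" using g(2) by (simp add: Lp_nonneg_def)
  then obtain g' where g': "g' \<in> borel_measurable borel" "\<And>x. g x \<le> g' x" "AE x in \<mu>. g' x = g x"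
    using ex_borel_majorant[OF \<mu>] by blast
  obtain \<rho>0 where \<rho>0: "Lp_nonneg \<mu> p \<rho>0"
    and exc: "\<And>c l. arc_length_curve c l \<Longrightarrow> \<not> upper_gradient_ineq (\<lambda>x. ereal (u x)) g c l \<Longrightarrow>
      line_integral c l \<rho>0 = \<infinity>"
    using g(1) by (auto simp: weak_upper_gradient_def exceptional_family_def)
  then obtain \<rho> where \<rho>: "\<rho> \<in> borel_measurable borel" "\<And>x. \<rho>0 x \<le> \<rho> x" "AE x in \<mu>. \<rho> x = \<rho>0 x"
    using ex_borel_majorant[OF \<mu>, of \<rho>0] unfolding Lp_nonneg_def by blast
  have Lp: "Lp_nonneg \<mu> p f" if "f \<in> borel_measurable borel" "AE x in \<mu>. f x = h x" "Lp_nonneg \<mu> p h" for f h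
  proof -
    have "(\<integral>\<^sup>+x. epowr (f x) p \<partial>\<mu>) = (\<integral>\<^sup>+x. epowr (h x) p \<partial>\<mu>)"
      by (intro nn_integral_cong_AE) (use that(2) in eventually_elim, auto)
    then show ?thesis
      using that(3) unfolding Lp_nonneg_borel_iff[OF \<mu> that(1)] by (simp add: Lp_nonneg_def)
  qed
  have Lg': "Lp_nonneg \<mu> p g'" and L\<rho>: "Lp_nonneg \<mu> p \<rho>"
    using Lp g' \<rho> g(2) \<rho>0 by blast+
  \<comment> \<open>A sequence taking only the values \<open>g'\<close> and \<rho>, so that a single
    \<sigma> controls both line integrals.\<close>
  let ?f = "\<lambda>n::nat. if n = 0 then g' else \<rho>"
  have f: "?f n \<in> borel_measurable borel" "Lp_nonneg \<mu> p (?f n)" for n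
    using g'(1) \<rho>(1) Lg' L\<rho> by auto
  obtain \<sigma> where \<sigma>: "\<sigma> \<in> borel_measurable borel" "Lp_nonneg \<mu> p \<sigma>"
    "\<And>c l n. arc_length_curve c l \<Longrightarrow> line_integral c l \<sigma> < \<infinity> \<Longrightarrow> line_integral c l (?f n) < \<infinity>"
    by (rule ex_common_exceptional_function[OF \<mu> p f]) (rule that)
  have "dominates (\<lambda>t. u (extend_curve c l t)) l (\<lambda>t. g' (extend_curve c l t))"
    if c: "arc_length_curve c l" and fin: "line_integral c l \<sigma> < \<infinity>" for c l
  proof (rule dominates_if_subcurves[OF c g'(1)])
    show "line_integral c l g' < \<infinity>" using \<sigma>(3)[OF c fin, of 0] by simp
    fix a b assume ab: "0 \<le> a" "a < b" "b \<le> l"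
    let ?c = "\<lambda>t. c (a + t)"
    have "line_integral ?c (b - a) \<rho>0 \<le> line_integral ?c (b - a) \<rho>"
      using \<rho>(2) by (rule line_integral_mono)
    also have "\<dots> \<le> line_integral c l \<rho>"
      unfolding line_integral_sub[OF c ab \<rho>(1)] line_integral_extend_curve[of c l]
      using ab by (intro set_nn_integral_mono_set) auto
    also have "\<dots> < \<infinity>" using \<sigma>(3)[OF c fin, of 1] by simp
    finally have "upper_gradient_ineq (\<lambda>x. ereal (u x)) g ?c (b - a)"
      using exc[OF arc_length_curve_sub[OF c ab]] by fastforce
    then show "upper_gradient_ineq (\<lambda>x. ereal (u x)) g' ?c (b - a)"
      using line_integral_mono[of g g', OF g'(2)] unfolding upper_gradient_ineq_real
      by (rule order_trans)
  qed
  then have "curvewise_gradient \<mu> p u g'"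
    unfolding curvewise_gradient_def using g'(1) Lg' \<sigma>(1,2)
    by (intro conjI exI[of _ \<sigma>]) auto
  then show ?thesis using that g'(3) by blast
qed

theorem ex_minimal_weak_upper_gradient:
  assumes \<mu>: "complete_borel_measure \<mu>" and p: "0 < p" and g0: "curvewise_gradient \<mu> p u g0"
  obtains g where "minimal_weak_upper_gradient \<mu> p (\<lambda>x. ereal (u x)) g"
proof -
  define E where "E g = (\<integral>\<^sup>+x. epowr (g x) p \<partial>\<mu>)" for g
  define I where "I = (INF g\<in>{g. curvewise_gradient \<mu> p u g}. E g)"
  have I_le: "I \<le> E g" if "curvewise_gradient \<mu> p u g" for g
    unfolding I_def using that by (intro INF_lower) simp
  have fin: "E g < \<infinity>" if "curvewise_gradient \<mu> p u g" for g
    using that by (simp add: E_def curvewise_gradient_def Lp_nonneg_def)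
  have "\<exists>g. curvewise_gradient \<mu> p u g \<and> E g < I + ennreal (1 / real (Suc n))" for n
  proof -
    \<comment> \<open>Finiteness, provided by \<open>g0\<close>, makes adding a positive number to
      \<open>I\<close> strictly increasing.\<close>
    have "I < \<infinity>" using I_le[OF g0] fin[OF g0] by (rule le_less_trans)
    then have "I < I + ennreal (1 / real (Suc n))"
      by (cases I) (auto simp: ennreal_less_iff simp flip: ennreal_plus)
    then show ?thesis unfolding I_def INF_less_iff by auto
  qed
  then obtain gs where gs: "\<And>n. curvewise_gradient \<mu> p u (gs n)"
    "\<And>n. E (gs n) < I + ennreal (1 / real (Suc n))"
    by metis
  define g where "g x = (INF n. gs n x)" for x
  have g: "curvewise_gradient \<mu> p u g"
    unfolding g_def using curvewise_gradient_INF[OF \<mu> p gs(1)] .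
  have "E g \<le> I"
  proof (rule ennreal_le_epsilon)
    fix e :: real assume "0 < e"
    then obtain n where "1 / real (Suc n) < e"
      using reals_Archimedean by (auto simp: inverse_eq_divide)
    have "E g \<le> E (gs n)"
      unfolding E_def g_def using p by (intro nn_integral_mono epowr_mono INF_lower) auto
    also have "\<dots> \<le> I + ennreal (1 / real (Suc n))" using gs(2) by (rule less_imp_le)
    also have "\<dots> \<le> I + ennreal e"
      using \<open>1 / real (Suc n) < e\<close> by (intro add_left_mono ennreal_leI) simp
    finally show "E g \<le> I + ennreal e" .
  qed
  have "AE x in \<mu>. g x \<le> h x"
    if h: "weak_upper_gradient \<mu> p (\<lambda>x. ereal (u x)) h" "Lp_nonneg \<mu> p h" for h
  proof -
    obtain h' where h': "curvewise_gradient \<mu> p u h'" "AE x in \<mu>. h' x = h x"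
      using ex_curvewise_gradient[OF \<mu> p h] by blast
    \<comment> \<open>This minimum is again a competitor, so its energy is at least
      \<open>I\<close>. Being at most \<open>g\<close> pointwise, with finite energy that is no
      smaller, it agrees with \<open>g\<close> almost everywhere.\<close>
    let ?m = "\<lambda>x. min (g x) (h' x)"
    have m: "curvewise_gradient \<mu> p u ?m" using curvewise_gradient_min[OF \<mu> p g h'(1)] .
    have [measurable]: "g \<in> borel_measurable \<mu>" "?m \<in> borel_measurable \<mu>"
      using g m complete_borel_measurable[OF \<mu>] by (auto simp: curvewise_gradient_def)
    have "E g \<le> E ?m" using \<open>E g \<le> I\<close> I_le[OF m] by (rule order_trans)
    have "(\<integral>\<^sup>+x. epowr (g x) p - epowr (?m x) p \<partial>\<mu>) = E g - E ?m"
      unfolding E_def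
    proof (rule nn_integral_diff)
      show "(\<integral>\<^sup>+x. epowr (?m x) p \<partial>\<mu>) \<noteq> \<infinity>" using fin[OF m] by (simp add: E_def)
      show "AE x in \<mu>. epowr (?m x) p \<le> epowr (g x) p" using p by (auto intro!: epowr_mono)
    qed measurable
    also have "\<dots> = 0" using \<open>E g \<le> E ?m\<close> fin[OF g] by (simp add: diff_eq_0_iff_ennreal)
    finally have "AE x in \<mu>. epowr (g x) p - epowr (?m x) p = 0"
      by (subst (asm) nn_integral_0_iff_AE) measurable
    moreover have "AE x in \<mu>. epowr (g x) p \<noteq> \<infinity>"
      using fin[OF g] unfolding E_def by (intro nn_integral_PInf_AE) auto
    ultimately show ?thesis using h'(2)
    proof eventually_elim
      case (elim x)
      then have "epowr (g x) p \<le> epowr (?m x) p"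
        by (simp add: diff_eq_0_iff_ennreal)
      then have "epowr (epowr (g x) p) (1 / p) \<le> epowr (epowr (?m x) p) (1 / p)"
        by (rule epowr_mono) (use p in simp)
      then have "g x \<le> min (g x) (h' x)"
        unfolding epowr_epowr_inverse(1)[OF p] .
      then show ?case using elim(3) by simp
    qed
  qed
  then have "minimal_weak_upper_gradient \<mu> p (\<lambda>x. ereal (u x)) g"
    using g curvewise_gradient_imp_weak_upper_gradient[OF \<mu> g]
    by (auto simp: minimal_weak_upper_gradient_def curvewise_gradient_def)
  then show ?thesis by (rule that)
qed

section \<open>The upper bound\<close>

text \<open>The constants off \<open>A\<close> and off \<open>B\<close> may differ, so the
  restriction to a single level set is applied twice, to the preimages under the curve.\<close>

lemma dominates_restrict_sets:
  assumes c: "arc_length_curve c l"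
    and dom: "dominates (\<lambda>t. u (extend_curve c l t)) l (\<lambda>t. g (extend_curve c l t))"
    and A: "A \<in> sets borel" "\<And>y. y \<notin> A \<Longrightarrow> u y = a"
    and B: "B \<in> sets borel" "\<And>y. y \<notin> B \<Longrightarrow> u y = b"
  shows "dominates (\<lambda>t. u (extend_curve c l t)) l
    (\<lambda>t. g (extend_curve c l t) * indicator (A \<inter> B) (extend_curve c l t))"
proof -
  note [measurable] = extend_curve_measurable[OF c] A(1) B(1)
  let ?pre = "\<lambda>S. extend_curve c l -` S"
  have pre: "?pre A \<in> sets borel" "?pre B \<in> sets borel"
    using measurable_sets[OF extend_curve_measurable[OF c]] A(1) B(1) by fastforce+
  have "dominates (\<lambda>t. u (extend_curve c l t)) l
    (\<lambda>t. g (extend_curve c l t) * indicator (?pre A) t * indicator (?pre B) t)"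
    by (rule dominates_restrict[OF dominates_restrict[OF dom pre(1)] pre(2), of a b]) (use A B in auto)
  moreover have "g (extend_curve c l t) * indicator (?pre A) t * indicator (?pre B) t
      = g (extend_curve c l t) * indicator (A \<inter> B) (extend_curve c l t)" for t
    by (auto simp: indicator_def)
  ultimately show ?thesis by simp
qed

section \<open>Measures of balls and annuli, and the capacity estimate from above\<close>

lemma metric_measure_space_ball:
  assumes "metric_measure_space \<mu>" "0 < r"
  shows "emeasure \<mu> (ball x r) = ennreal (measure \<mu> (ball x r))" "0 < measure \<mu> (ball x r)"
    "emeasure \<mu> (ball x r) < \<infinity>"
proof -
  show fin: "emeasure \<mu> (ball x r) < \<infinity>" using assms by (simp add: metric_measure_space_def)
  show eq: "emeasure \<mu> (ball x r) = ennreal (measure \<mu> (ball x r))"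
    using fin by (intro emeasure_eq_ennreal_measure) auto
  have "0 < emeasure \<mu> (ball x r)" using assms by (simp add: metric_measure_space_def)
  then show "0 < measure \<mu> (ball x r)" unfolding eq by simp
qed

lemma complete_borel_measure_sets:
  assumes "complete_borel_measure \<mu>" "S \<in> sets borel"
  shows "S \<in> sets \<mu>"
  using assms by (auto simp: complete_borel_measure_def intro: sets_completionI_sets)

lemma emeasure_ball_diff:
  assumes "metric_measure_space \<mu>" "0 < R"
  shows "emeasure \<mu> (ball x R - ball x r) = ennreal (measure \<mu> (ball x R - ball x r))"
proof -
  have "ball x R \<in> sets \<mu>"
    using assms(1) complete_borel_measure_sets[OF _ borel_open[OF open_ball]]
    by (auto simp: metric_measure_space_def)
  then have "emeasure \<mu> (ball x R - ball x r) \<le> emeasure \<mu> (ball x R)"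
    by (intro emeasure_mono) auto
  also have "\<dots> < \<infinity>" using metric_measure_space_ball[OF assms] by simp
  finally show ?thesis by (intro emeasure_eq_ennreal_measure) auto
qed

lemma variational_capacity_ball_le:
  fixes \<mu> :: "'a::metric_space measure"
  assumes \<mu>: "metric_measure_space \<mu>" and p: "1 \<le> p" and rR: "0 < r" "r < R"
  shows "variational_capacity \<mu> p (ball x r) (ball x R)
    \<le> ennreal ((1 / (R - r)) powr p * measure \<mu> (ball x R - ball x r))"
proof -
  have \<mu>b: "complete_borel_measure \<mu>" using \<mu> by (simp add: metric_measure_space_def)
  define u where "u y = max 0 (min 1 ((R - dist x y) / (R - r)))" for y
  define g0 :: "'a \<Rightarrow> ennreal" where
    "g0 y = ennreal (1 / (R - r)) * indicator (ball x R \<inter> - ball x r) y" for y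
  have ub: "u \<in> borel_measurable borel"
    unfolding u_def by (intro borel_measurable_continuous_onI continuous_intros) (use rR in auto)
  have "ball x R \<inter> - ball x r \<in> sets borel"
    by (intro sets.Int borel_open borel_closed) auto
  then have [measurable]: "indicator (ball x R \<inter> - ball x r) \<in> borel_measurable borel"
    by (rule borel_measurable_indicator)
  have g0b: "g0 \<in> borel_measurable borel" unfolding g0_def by measurable
  have u01: "0 \<le> u y" "u y \<le> 1" for y by (auto simp: u_def)
  have u0: "u y = 0" if "y \<notin> ball x R" for y
    using that rR by (auto simp: u_def max_def min_def field_simps)
  have u1: "u y = 1" if "y \<notin> - ball x r" for y
    using that rR by (auto simp: u_def max_def min_def field_simps)
  have lip: "\<bar>u y - u z\<bar> \<le> dist y z / (R - r)" for y z
  proof -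
    have "\<bar>u y - u z\<bar> \<le> \<bar>(R - dist x y) / (R - r) - (R - dist x z) / (R - r)\<bar>"
      unfolding u_def by (auto simp: max_def min_def)
    also have "\<dots> = \<bar>dist x z - dist x y\<bar> / (R - r)"
      using rR by (simp flip: diff_divide_distrib)
    also have "\<dots> \<le> dist y z / (R - r)"
      using rR abs_dist_diff_le[of z x y]
      by (intro divide_right_mono) (auto simp: dist_commute)
    finally show ?thesis .
  qed
  have dom: "dominates (\<lambda>t. u (extend_curve c l t)) l (\<lambda>t. g0 (extend_curve c l t))"
    if c: "arc_length_curve c l" for c l
  proof -
    have int: "(\<integral>\<^sup>+t\<in>{a..b}. ennreal (1 / (R - r)) \<partial>lborel) = ennreal ((b - a) / (R - r))"
      if "a \<le> b" for a b :: real
      using that rR by (subst nn_integral_cmult_indicator) (auto simp flip: ennreal_mult)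
    \<comment> \<open>The constant comes from the Lipschitz bounds for \<open>u\<close> and
      \<open>c\<close>; it is cut down to the annulus afterwards, since \<open>u\<close> is 0 off
      the large ball and 1 on the small one.\<close>
    have "dominates (\<lambda>t. u (extend_curve c l t)) l (\<lambda>t. ennreal (1 / (R - r)))"
      unfolding dominates_def
    proof (intro conjI allI impI)
      show "(\<integral>\<^sup>+t\<in>{0..l}. ennreal (1 / (R - r)) \<partial>lborel) < \<infinity>"
        using c int[of 0 l] by (simp add: arc_length_curve_def)
      fix a b assume ab: "0 \<le> a \<and> a \<le> b \<and> b \<le> l"
      have "\<bar>u (c a) - u (c b)\<bar> \<le> dist (c a) (c b) / (R - r)" by (rule lip)
      also have "\<dots> \<le> (b - a) / (R - r)"
        using arc_length_curve_dist_le[OF c, of a b] ab rR by (intro divide_right_mono) auto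
      finally show "ennreal \<bar>u (extend_curve c l a) - u (extend_curve c l b)\<bar>
          \<le> (\<integral>\<^sup>+t\<in>{a..b}. ennreal (1 / (R - r)) \<partial>lborel)"
        using ab by (simp add: int ennreal_leI)
    qed simp
    from dominates_restrict_sets[OF c this, of "ball x R" 0 "- ball x r" 1] u0 u1
    show ?thesis unfolding g0_def by simp
  qed
  have E0: "(\<integral>\<^sup>+y. epowr (g0 y) p \<partial>\<mu>)
      = ennreal ((1 / (R - r)) powr p * measure \<mu> (ball x R - ball x r))"
  proof -
    have [measurable]: "ball x R - ball x r \<in> sets \<mu>"
      using complete_borel_measure_sets[OF \<mu>b] by auto
    have "(\<integral>\<^sup>+y. epowr (g0 y) p \<partial>\<mu>)
        = (\<integral>\<^sup>+y. ennreal ((1 / (R - r)) powr p) * indicator (ball x R - ball x r) y \<partial>\<mu>)"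
      using rR by (intro nn_integral_cong) (auto simp: g0_def indicator_def)
    also have "\<dots> = ennreal ((1 / (R - r)) powr p * measure \<mu> (ball x R - ball x r))"
      using emeasure_ball_diff[OF \<mu>, of R x r] rR
      by (subst nn_integral_cmult_indicator) (auto simp flip: ennreal_mult)
    finally show ?thesis .
  qed
  have g0: "curvewise_gradient \<mu> p u g0"
    unfolding curvewise_gradient_def
  \<comment> \<open>The zero function excludes no curve, as \<open>dom\<close> holds along all arc
    length curves.\<close>
  proof (intro conjI exI[of _ "\<lambda>_. 0"])
    show "Lp_nonneg \<mu> p g0" using E0 by (simp add: Lp_nonneg_borel_iff[OF \<mu>b g0b])
    show "Lp_nonneg \<mu> p (\<lambda>_. 0)" by (simp add: Lp_nonneg_def)
  qed (use g0b dom in auto)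
  \<comment> \<open>The capacity admits only pairs with a minimal weak upper gradient, so one must
    exist for \<open>u\<close>; minimality then bounds it by \<open>g0\<close>.\<close>
  obtain g where g: "minimal_weak_upper_gradient \<mu> p (\<lambda>y. ereal (u y)) g"
    using ex_minimal_weak_upper_gradient[OF \<mu>b _ g0] p by auto
  have ug: "upper_gradient (\<lambda>y. ereal (u y)) g0"
    unfolding upper_gradient_def using g0b upper_gradient_ineq_if_dominates dom by blast
  have "newtonian_norm \<mu> p (\<lambda>y. ereal (u y)) < \<infinity>"
  proof -
    have [measurable]: "ball x R \<in> sets \<mu>"
      using complete_borel_measure_sets[OF \<mu>b] by auto
    have "(\<integral>\<^sup>+y. epowr (e2ennreal \<bar>ereal (u y)\<bar>) p \<partial>\<mu>) \<le> (\<integral>\<^sup>+y. indicator (ball x R) y \<partial>\<mu>)"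
    proof (rule nn_integral_mono)
      fix y
      have "u y powr p \<le> 1 powr p" using u01[of y] p by (intro powr_mono2) auto
      then show "epowr (e2ennreal \<bar>ereal (u y)\<bar>) p \<le> indicator (ball x R) y"
        using u0[of y] u01[of y] by (auto simp: indicator_def)
    qed
    also have "\<dots> < \<infinity>" using metric_measure_space_ball(3)[OF \<mu>, of R x] rR by simp
    finally have 1: "(\<integral>\<^sup>+y. epowr (e2ennreal \<bar>ereal (u y)\<bar>) p \<partial>\<mu>) < \<infinity>" .
    have "(INF g\<in>{g. upper_gradient (\<lambda>y. ereal (u y)) g}. \<integral>\<^sup>+y. epowr (g y) p \<partial>\<mu>)
        \<le> (\<integral>\<^sup>+y. epowr (g0 y) p \<partial>\<mu>)"
      using ug by (intro INF_lower) simp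
    also have "\<dots> < \<infinity>" unfolding E0 by simp
    finally show ?thesis using 1 by (simp add: newtonian_norm_def)
  qed
  then have adm: "cap_admissible \<mu> p (ball x r) (ball x R) (\<lambda>y. ereal (u y))"
    using complete_borel_measurable[OF \<mu>b ub] u0 u1 u01
    by (auto simp: cap_admissible_def newtonian_space_def indicator_def)
  have "variational_capacity \<mu> p (ball x r) (ball x R) \<le> (\<integral>\<^sup>+y\<in>ball x R. epowr (g y) p \<partial>\<mu>)"
    unfolding variational_capacity_def
    by (rule INF_lower2[of "(\<lambda>y. ereal (u y), g)"]) (use adm g in auto)
  also have "\<dots> \<le> (\<integral>\<^sup>+y. epowr (g0 y) p \<partial>\<mu>)"
  proof (rule nn_integral_mono_AE)
    have "AE y in \<mu>. g y \<le> g0 y"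
      using g curvewise_gradient_imp_weak_upper_gradient[OF \<mu>b g0] g0
      by (simp add: minimal_weak_upper_gradient_def curvewise_gradient_def)
    then show "AE y in \<mu>. epowr (g y) p * indicator (ball x R) y \<le> epowr (g0 y) p"
    proof eventually_elim
      case (elim y)
      then have "epowr (g y) p \<le> epowr (g0 y) p" using p by (intro epowr_mono) auto
      then show ?case by (auto simp: indicator_def)
    qed
  qed
  finally show ?thesis unfolding E0 .
qed

section \<open>The lower bound\<close>

text \<open>Shrinking the radius by a factor close enough to 1 removes at most half of the measure;
  finitely many such steps more than halve the radius.\<close>

lemma annular_decay_imp_doubling:
  fixes \<mu> :: "'a::metric_space measure"
  assumes \<mu>: "metric_measure_space \<mu>"
    and C: "1 \<le> C" "\<And>r R. 0 < r \<Longrightarrow> r < R \<Longrightarrow>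
      measure \<mu> (ball x R - ball x r) \<le> C * (1 - r / R) * measure \<mu> (ball x R)"
  obtains D where "1 \<le> D"
    "\<And>r R. 0 < R \<Longrightarrow> R / 2 \<le> r \<Longrightarrow> measure \<mu> (ball x R) \<le> D * measure \<mu> (ball x r)"
proof -
  have sets: "ball x r \<in> sets \<mu>" for r
    using \<mu> complete_borel_measure_sets[OF _ borel_open[OF open_ball]]
    by (auto simp: metric_measure_space_def)
  have fm: "ball x r \<in> fmeasurable \<mu>" if "0 < r" for r
    using metric_measure_space_ball(3)[OF \<mu> that] sets by (auto simp: fmeasurable_def)
  have mono: "measure \<mu> (ball x r) \<le> measure \<mu> (ball x R)" if "0 < r" "r \<le> R" for r R
    using that sets fm by (intro measure_mono_fmeasurable) auto
  \<comment> \<open>This solves \<open>C * (1 - \<theta>) = 1 / 2\<close>; the bound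
    \<open>1 \<le> C\<close> keeps it positive.\<close>
  define \<theta> where "\<theta> = 1 - 1 / (2 * C)"
  have \<theta>: "0 < \<theta>" "\<theta> < 1" using C(1) by (auto simp: \<theta>_def field_simps)
  have step: "measure \<mu> (ball x r) \<le> 2 * measure \<mu> (ball x (\<theta> * r))" if r: "0 < r" for r
  proof -
    have \<theta>r: "0 < \<theta> * r" "\<theta> * r < r" using \<theta> r by auto
    have "measure \<mu> (ball x r - ball x (\<theta> * r)) \<le> C * (1 - \<theta> * r / r) * measure \<mu> (ball x r)"
      using C(2)[OF \<theta>r] .
    also have "C * (1 - \<theta> * r / r) = 1 / 2" using C(1) r by (simp add: \<theta>_def)
    finally have "measure \<mu> (ball x r - ball x (\<theta> * r)) \<le> 1 / 2 * measure \<mu> (ball x r)" .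
    moreover have "measure \<mu> (ball x r - ball x (\<theta> * r)) = measure \<mu> (ball x r) - measure \<mu> (ball x (\<theta> * r))"
      using fm[OF r] fm[OF \<theta>r(1)] \<theta>r(2) by (intro measurable_measure_Diff) auto
    ultimately show ?thesis by simp
  qed
  have iter: "measure \<mu> (ball x R) \<le> 2 ^ n * measure \<mu> (ball x (\<theta> ^ n * R))" if "0 < R" for R n
  proof (induction n)
    case (Suc n)
    note Suc.IH
    also have "2 ^ n * measure \<mu> (ball x (\<theta> ^ n * R))
        \<le> 2 ^ n * (2 * measure \<mu> (ball x (\<theta> * (\<theta> ^ n * R))))"
      using \<theta> that by (intro mult_left_mono step) auto
    finally show ?case by (simp add: mult_ac)
  qed simp
  obtain n where n: "\<theta> ^ n < 1 / 2" using real_arch_pow_inv[of "1/2" \<theta>] \<theta> by auto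
  show ?thesis
  proof (rule that[of "2 ^ n"])
    fix r R :: real assume rR: "0 < R" "R / 2 \<le> r"
    have "\<theta> ^ n * R \<le> 1 / 2 * R" using n rR by (intro mult_right_mono) auto
    then have le: "\<theta> ^ n * R \<le> r" using rR(2) by linarith
    then have "measure \<mu> (ball x (\<theta> ^ n * R)) \<le> measure \<mu> (ball x r)"
      using \<theta> rR(1) by (intro mono le) simp
    then show "measure \<mu> (ball x R) \<le> 2 ^ n * measure \<mu> (ball x r)"
      using iter[OF rR(1), of n] by (meson mult_left_mono order_trans zero_le_numeral zero_le_power)
  qed simp
qed

text \<open>This removes the small multiple of the exceptional function that turns a weak upper
  gradient into an upper gradient.\<close>

lemma ennreal_le_epsilon_mult:
  fixes a b c :: ennreal
  assumes le: "\<And>e. 0 < e \<Longrightarrow> a \<le> b + ennreal e * c" and c: "c < \<infinity>"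
  shows "a \<le> b"
proof (rule ennreal_le_epsilon)
  fix d :: real assume d: "0 < d"
  obtain k where k: "c = ennreal k" "0 \<le> k" using c by (cases c) auto
  \<comment> \<open>Dividing by \<open>k + 1\<close> rather than \<open>k\<close> covers
    \<open>k = 0\<close>.\<close>
  have "a \<le> b + ennreal (d / (k + 1)) * c" using d k by (intro le) auto
  also have "ennreal (d / (k + 1)) * c = ennreal (d * (k / (k + 1)))"
    using d k by (simp flip: ennreal_mult)
  also have "b + \<dots> \<le> b + ennreal d"
  proof (intro add_left_mono ennreal_leI)
    have "d * (k / (k + 1)) \<le> d * 1" using d k by (intro mult_left_mono) auto
    then show "d * (k / (k + 1)) \<le> d" by simp
  qed
  finally show "a \<le> b + ennreal d" .
qed

lemma le_one_add_epowr:
  assumes "1 \<le> p"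
  shows "x \<le> 1 + epowr x p"
proof (cases x)
  case (real a)
  have "a \<le> 1 + a powr p"
  proof (cases "a \<le> 1")
    case True
    then show ?thesis using powr_ge_zero[of a p] by linarith
  next
    case False
    then have "a powr 1 \<le> a powr p" using assms by (intro powr_mono) auto
    then show ?thesis using False by simp
  qed
  then show ?thesis using real by (simp flip: ennreal_1 ennreal_plus add: ennreal_leI)
qed simp

text \<open>With \<open>s\<close> adapted to the size of the integrals, this replaces Hoelder's inequality.\<close>

lemma le_powr_mult_epowr_add:
  assumes "1 \<le> p" "0 < s"
  shows "x \<le> ennreal (s powr (1 - p)) * epowr x p + ennreal s"
proof (cases x)
  case (real a)
  have "a \<le> s powr (1 - p) * a powr p + s"
  proof (cases "a \<le> s")
    case True
    then show ?thesis by (simp add: add_increasing)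
  next
    case False
    then have "0 < a" using assms by simp
    have "a = a powr (1 - p) * a powr p" using \<open>0 < a\<close> by (simp flip: powr_add)
    also have "\<dots> \<le> s powr (1 - p) * a powr p"
      using assms False by (intro mult_right_mono powr_mono2') auto
    finally show ?thesis using assms by simp
  qed
  then show ?thesis
    using real assms by (simp flip: ennreal_mult ennreal_plus add: ennreal_leI)
qed (use assms in \<open>simp add: ennreal_mult_top\<close>)

text \<open>Integrate the pointwise bound of \<open>f\<close> by 1 plus its \<open>p\<close>-th
  power.\<close>

lemma Lp_nonneg_finite_integral:
  assumes f: "Lp_nonneg \<mu> p f" and p: "1 \<le> p" and A: "A \<in> sets \<mu>" "emeasure \<mu> A < \<infinity>"
  shows "(\<integral>\<^sup>+y\<in>A. f y \<partial>\<mu>) < \<infinity>"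
proof -
  have [measurable]: "f \<in> borel_measurable \<mu>" using f by (simp add: Lp_nonneg_def)
  note [measurable] = A(1)
  have "(\<integral>\<^sup>+y\<in>A. f y \<partial>\<mu>) \<le> (\<integral>\<^sup>+y. indicator A y + epowr (f y) p \<partial>\<mu>)"
    using le_one_add_epowr[OF p] by (intro nn_integral_mono) (auto simp: indicator_def)
  also have "\<dots> = emeasure \<mu> A + (\<integral>\<^sup>+y. epowr (f y) p \<partial>\<mu>)"
    by (subst nn_integral_add) auto
  also have "\<dots> < \<infinity>" using f A by (simp add: Lp_nonneg_def)
  finally show ?thesis .
qed

text \<open>The Poincare inequality speaks of upper gradients, while \<open>g\<close> is only weak.
  Adding \<open>e\<close> times an exceptional function repairs this for every positive
  \<open>e\<close>, and \<open>e\<close> then tends to 0. The factor 1 over the measure of the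
  dilated ball is bounded by that of the original ball, which cancels.\<close>

lemma poincare_test_function:
  fixes \<mu> :: "'a::metric_space measure"
  assumes \<mu>: "metric_measure_space \<mu>" and p: "1 \<le> p"
    and PI: "\<And>f g. ereal_integrable \<mu> f \<Longrightarrow> upper_gradient f g \<Longrightarrow>
      (\<integral>\<^sup>+y\<in>ball x T. e2ennreal \<bar>f y - ereal (average \<mu> f (ball x T))\<bar> \<partial>\<mu>) / emeasure \<mu> (ball x T)
       \<le> ennreal K * ((\<integral>\<^sup>+y\<in>ball x (\<Lambda> * T). g y \<partial>\<mu>) / emeasure \<mu> (ball x (\<Lambda> * T)))"
    and T: "0 < T" "1 \<le> \<Lambda>" and rR: "0 < r" "r < R"
    and u: "cap_admissible \<mu> p (ball x r) (ball x R) u"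
    and g: "weak_upper_gradient \<mu> p u g" "Lp_nonneg \<mu> p g"
  shows "(\<integral>\<^sup>+y\<in>ball x T. e2ennreal \<bar>u y - ereal (average \<mu> u (ball x T))\<bar> \<partial>\<mu>)
    \<le> ennreal K * (\<integral>\<^sup>+y\<in>ball x R - ball x r. g y \<partial>\<mu>)"
proof -
  have \<mu>b: "complete_borel_measure \<mu>" using \<mu> by (simp add: metric_measure_space_def)
  have sets[measurable]: "ball x r \<in> sets \<mu>" for r
    using complete_borel_measure_sets[OF \<mu>b borel_open[OF open_ball]] .
  define v where "v y = real_of_ereal (u y)" for y
  have rng: "0 \<le> u y" "u y \<le> 1" for y
  proof -
    have "0 \<le> u y \<and> u y \<le> 1"
    proof (cases "y \<in> ball x R")
      case True
      then have "indicator (ball x r) y \<le> u y \<and> u y \<le> 1"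
        using u by (simp add: cap_admissible_def)
      moreover have "(0::ereal) \<le> indicator (ball x r) y" by simp
      ultimately show ?thesis by (blast intro: order_trans)
    next
      case False
      then show ?thesis using u by (simp add: cap_admissible_def)
    qed
    then show "0 \<le> u y" "u y \<le> 1" by auto
  qed
  have uv: "u y = ereal (v y)" for y
    unfolding v_def using rng[of y] by (cases "u y") auto
  then have u_eq: "u = (\<lambda>y. ereal (v y))" by auto
  have v0: "v y = 0" if "y \<notin> ball x R" for y
    using u that by (simp add: cap_admissible_def v_def)
  have v1: "v y = 1" if "y \<notin> - ball x r" for y
  proof -
    have "y \<in> ball x R" "y \<in> ball x r" using that rR by auto
    then have "indicator (ball x r) y \<le> u y" using u unfolding cap_admissible_def by blast
    then have "1 \<le> u y" using \<open>y \<in> ball x r\<close> by simp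
    then have "u y = 1" using rng[of y] by (intro antisym)
    then show ?thesis by (simp add: v_def)
  qed
  obtain g' where g': "curvewise_gradient \<mu> p v g'" "AE y in \<mu>. g' y = g y"
    using ex_curvewise_gradient[OF \<mu>b, of p v g] g p unfolding u_eq by auto
  obtain \<rho> where \<rho>: "\<rho> \<in> borel_measurable borel" "Lp_nonneg \<mu> p \<rho>"
    "\<And>c l. arc_length_curve c l \<Longrightarrow> line_integral c l \<rho> < \<infinity> \<Longrightarrow>
      dominates (\<lambda>t. v (extend_curve c l t)) l (\<lambda>t. g' (extend_curve c l t))"
    using curvewise_gradientE[OF g'(1)] by blast
  define A where "A = ball x R \<inter> - ball x r"
  have A_eq: "A = ball x R - ball x r" by (auto simp: A_def)
  have Ab: "A \<in> sets borel" unfolding A_def by (intro sets.Int borel_open borel_closed) auto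
  note [measurable] = Ab complete_borel_measure_sets[OF \<mu>b Ab]
  have g'b[measurable]: "g' \<in> borel_measurable borel" using g'(1) by (simp add: curvewise_gradient_def)
  note [measurable] = \<rho>(1) complete_borel_measurable[OF \<mu>b \<rho>(1)] complete_borel_measurable[OF \<mu>b g'b]
  \<comment> \<open>Along curves where \<rho> has finite integral the first summand suffices, since
    \<open>v\<close> is constant off the large ball and on the small one; along all others the
    second has infinite integral.\<close>
  define h where "h e y = g' y * indicator A y + ennreal e * \<rho> y" for e y
  have hb: "h e \<in> borel_measurable borel" for e unfolding h_def by measurable
  have ug: "upper_gradient u (h e)" if e: "0 < e" for e
    unfolding upper_gradient_def u_eq
  proof (intro conjI allI impI hb)
    fix c :: "real \<Rightarrow> 'a" and l assume c: "arc_length_curve c l"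
    note [measurable] = extend_curve_measurable[OF c]
    show "upper_gradient_ineq (\<lambda>y. ereal (v y)) (h e) c l"
    proof (cases "line_integral c l \<rho> < \<infinity>")
      case True
      have "dominates (\<lambda>t. v (extend_curve c l t)) l
          (\<lambda>t. g' (extend_curve c l t) * indicator A (extend_curve c l t))"
        unfolding A_def
        by (rule dominates_restrict_sets[OF c \<rho>(3)[OF c True], of _ 0 _ 1]) (use v0 v1 in auto)
      then have "upper_gradient_ineq (\<lambda>y. ereal (v y)) (\<lambda>y. g' y * indicator A y) c l"
        by (intro upper_gradient_ineq_if_dominates[OF c]) simp
      moreover have "line_integral c l (\<lambda>y. g' y * indicator A y) \<le> line_integral c l (h e)"
        by (rule line_integral_mono) (simp add: h_def)
      ultimately show ?thesis unfolding upper_gradient_ineq_real by (rule order_trans)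
    next
      case False
      have "line_integral c l (\<lambda>y. ennreal e * \<rho> y) = ennreal e * line_integral c l \<rho>"
        unfolding line_integral_extend_curve
        by (subst nn_integral_cmult[symmetric]) (auto simp: mult.assoc)
      also have "line_integral c l \<rho> = top" using False by (simp add: not_less top_unique)
      also have "ennreal e * top = \<infinity>" using e by (simp add: ennreal_mult_top)
      finally have "line_integral c l (h e) = \<infinity>"
        using line_integral_mono[of "\<lambda>y. ennreal e * \<rho> y" "h e" c l] by (simp add: h_def top_unique)
      then show ?thesis by (simp add: upper_gradient_ineq_real)
    qed
  qed
  have int: "ereal_integrable \<mu> u"
    unfolding ereal_integrable_def
  proof
    show "u \<in> borel_measurable \<mu>" using u by (simp add: cap_admissible_def newtonian_space_def)
    have "(\<integral>\<^sup>+y. e2ennreal \<bar>u y\<bar> \<partial>\<mu>) \<le> (\<integral>\<^sup>+y. indicator (ball x R) y \<partial>\<mu>)"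
    proof (rule nn_integral_mono)
      fix y
      have "0 \<le> v y" "v y \<le> 1" using rng[of y] unfolding uv by auto
      then show "e2ennreal \<bar>u y\<bar> \<le> indicator (ball x R) y"
        using v0[of y] by (auto simp: uv indicator_def)
    qed
    also have "\<dots> < \<infinity>" using metric_measure_space_ball(3)[OF \<mu>, of R x] rR by simp
    finally show "(\<integral>\<^sup>+y. e2ennreal \<bar>u y\<bar> \<partial>\<mu>) < \<infinity>" .
  qed
  define Q where "Q = (\<integral>\<^sup>+y\<in>ball x T. e2ennreal \<bar>u y - ereal (average \<mu> u (ball x T))\<bar> \<partial>\<mu>)"
  define P where "P = (\<integral>\<^sup>+y\<in>A. g' y \<partial>\<mu>)"
  define J where "J = (\<integral>\<^sup>+y\<in>ball x (\<Lambda> * T). \<rho> y \<partial>\<mu>)"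
  have \<Lambda>T: "0 < \<Lambda> * T" "T \<le> \<Lambda> * T" using T by auto
  define m where "m = measure \<mu> (ball x T)"
  define M where "M = measure \<mu> (ball x (\<Lambda> * T))"
  have mM: "emeasure \<mu> (ball x T) = ennreal m" "emeasure \<mu> (ball x (\<Lambda> * T)) = ennreal M" "0 < m" "0 < M"
    using metric_measure_space_ball[OF \<mu> T(1)] metric_measure_space_ball[OF \<mu> \<Lambda>T(1)]
    by (auto simp: m_def M_def)
  have "emeasure \<mu> (ball x T) \<le> emeasure \<mu> (ball x (\<Lambda> * T))"
    using \<Lambda>T by (intro emeasure_mono subset_ball) auto
  then have "m \<le> M" using mM by simp
  have "Q \<le> ennreal K * P + ennreal e * (ennreal K * J)" if e: "0 < e" for e
  proof -
    have "(\<integral>\<^sup>+y\<in>ball x (\<Lambda> * T). h e y \<partial>\<mu>)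
        \<le> (\<integral>\<^sup>+y. g' y * indicator A y + ennreal e * (\<rho> y * indicator (ball x (\<Lambda> * T)) y) \<partial>\<mu>)"
      by (intro nn_integral_mono) (auto simp: h_def indicator_def)
    also have "\<dots> = P + ennreal e * J"
      unfolding P_def J_def by (subst nn_integral_add) (auto simp: nn_integral_cmult)
    finally have le: "(\<integral>\<^sup>+y\<in>ball x (\<Lambda> * T). h e y \<partial>\<mu>) \<le> P + ennreal e * J" .
    have "Q / ennreal m \<le> ennreal K * ((P + ennreal e * J) / ennreal M)"
      using PI[OF int ug[OF e]] unfolding Q_def[symmetric] mM
      by (rule order_trans) (intro mult_left_mono divide_right_mono_ennreal le, simp)
    also have "\<dots> \<le> ennreal K * ((P + ennreal e * J) / ennreal m)"
    proof (intro mult_left_mono)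
      have "inverse (ennreal M) \<le> inverse (ennreal m)"
        using \<open>m \<le> M\<close> mM by (simp add: inverse_ennreal ennreal_leI)
      then show "(P + ennreal e * J) / ennreal M \<le> (P + ennreal e * J) / ennreal m"
        unfolding divide_ennreal_def by (intro mult_left_mono) auto
    qed simp
    finally have "Q / ennreal m * ennreal m \<le> ennreal K * ((P + ennreal e * J) / ennreal m) * ennreal m"
      by (rule mult_right_mono) simp
    moreover have "z / ennreal m * ennreal m = z" for z
      using mM(3) by (simp add: ennreal_divide_times ennreal_mult_divide_eq)
    ultimately show ?thesis by (simp add: mult.assoc distrib_left mult.left_commute)
  qed
  moreover have "ennreal K * J < \<infinity>"
    using Lp_nonneg_finite_integral[OF \<rho>(2) p, of "ball x (\<Lambda> * T)"] mM
    by (auto simp: J_def ennreal_mult_less_top)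
  ultimately have "Q \<le> ennreal K * P" by (rule ennreal_le_epsilon_mult)
  moreover have "P = (\<integral>\<^sup>+y\<in>A. g y \<partial>\<mu>)"
    unfolding P_def by (rule nn_integral_cong_AE) (use g'(2) in eventually_elim, auto)
  ultimately show ?thesis by (simp add: Q_def A_eq)
qed

text \<open>The value \<open>a\<close> cannot be close to both \<open>0\<close> and \<open>1\<close>.\<close>

lemma cap_admissible_oscillation:
  fixes \<mu> :: "'a::metric_space measure"
  assumes \<mu>: "metric_measure_space \<mu>" and rR: "0 < r" "r < R" "R \<le> T"
    and u: "cap_admissible \<mu> p (ball x r) (ball x R) u"
    and \<gamma>: "\<gamma> * measure \<mu> (ball x R) \<le> measure \<mu> (ball x T)"
    and D: "1 \<le> D" "measure \<mu> (ball x R) \<le> D * measure \<mu> (ball x r)"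
  shows "ennreal (min ((\<gamma> - 1) / 2) (1 / (2 * D)) * measure \<mu> (ball x R))
    \<le> (\<integral>\<^sup>+y\<in>ball x T. e2ennreal \<bar>u y - ereal a\<bar> \<partial>\<mu>)" (is "_ \<le> ?Q")
proof -
  have sets[measurable]: "ball x s \<in> sets \<mu>" for s
    using \<mu> complete_borel_measure_sets[OF _ borel_open[OF open_ball]]
    by (auto simp: metric_measure_space_def)
  define m where "m = measure \<mu> (ball x R)"
  have m: "0 < m" using metric_measure_space_ball(2)[OF \<mu>] rR by (simp add: m_def)
  \<comment> \<open>Chebyshev's inequality at level 1/2; it is used for the outer annulus and for
    the small ball.\<close>
  have half: "ennreal (1 / 2 * measure \<mu> S) \<le> ?Q"
    if S: "S \<in> sets \<mu>" "S \<subseteq> ball x T" "\<And>y. y \<in> S \<Longrightarrow> ennreal (1 / 2) \<le> e2ennreal \<bar>u y - ereal a\<bar>" for S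
  proof -
    have "emeasure \<mu> S \<le> emeasure \<mu> (ball x T)" using S by (intro emeasure_mono) auto
    also have "\<dots> < \<infinity>" using metric_measure_space_ball(3)[OF \<mu>] rR by auto
    finally have "emeasure \<mu> S = ennreal (measure \<mu> S)"
      by (intro emeasure_eq_ennreal_measure) auto
    then have "ennreal (1 / 2 * measure \<mu> S) = ennreal (1 / 2) * emeasure \<mu> S"
      using ennreal_mult[of "1 / 2" "measure \<mu> S"] by simp
    also have "\<dots> = (\<integral>\<^sup>+y. ennreal (1 / 2) * indicator S y \<partial>\<mu>)"
      using S(1) by (rule nn_integral_cmult_indicator[symmetric])
    also have "\<dots> \<le> ?Q"
    proof (rule nn_integral_mono)
      fix y
      show "ennreal (1 / 2) * indicator S y \<le> e2ennreal \<bar>u y - ereal a\<bar> * indicator (ball x T) y"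
        using S(2) S(3)[of y] by (cases "y \<in> S") auto
    qed
    finally show ?thesis .
  qed
  show ?thesis
  proof (cases "1 / 2 \<le> \<bar>a\<bar>")
    case True
    \<comment> \<open>Here \<open>a\<close> is far from the value 0 of \<open>u\<close> on the outer
      annulus, whose measure is at least \<open>(\<gamma> - 1) * m\<close>.\<close>
    have Q: "ennreal (1 / 2 * measure \<mu> (ball x T - ball x R)) \<le> ?Q"
    proof (rule half)
      fix y assume "y \<in> ball x T - ball x R"
      then have "u y = 0" using u by (simp add: cap_admissible_def)
      then have "\<bar>u y - ereal a\<bar> = ereal \<bar>a\<bar>" by simp
      then show "ennreal (1 / 2) \<le> e2ennreal \<bar>u y - ereal a\<bar>"
        using True by (simp only: e2ennreal_ereal ennreal_leI)
    qed (use sets in auto)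
    have diff: "measure \<mu> (ball x T - ball x R) = measure \<mu> (ball x T) - m"
      unfolding m_def
    proof (rule measurable_measure_Diff)
      show "ball x T \<in> fmeasurable \<mu>"
        using metric_measure_space_ball(3)[OF \<mu>, of T x] rR sets by (auto simp: fmeasurable_def)
      show "ball x R \<subseteq> ball x T" using rR(3) by (rule subset_ball)
    qed (rule sets)
    have "min ((\<gamma> - 1) / 2) (1 / (2 * D)) * m \<le> (\<gamma> - 1) / 2 * m"
      using m by (intro mult_right_mono min.cobounded1) simp
    then have "min ((\<gamma> - 1) / 2) (1 / (2 * D)) * m \<le> 1 / 2 * (measure \<mu> (ball x T) - m)"
      using \<gamma> unfolding m_def by (simp add: algebra_simps)
    then have "ennreal (min ((\<gamma> - 1) / 2) (1 / (2 * D)) * m)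
        \<le> ennreal (1 / 2 * (measure \<mu> (ball x T) - m))" by (rule ennreal_leI)
    also have "\<dots> \<le> ?Q" using Q unfolding diff .
    finally show ?thesis unfolding m_def .
  next
    case False
    \<comment> \<open>Here \<open>a\<close> is far from the value 1 of \<open>u\<close> on the small
      ball, whose measure is at least \<open>m / D\<close>.\<close>
    have Q: "ennreal (1 / 2 * measure \<mu> (ball x r)) \<le> ?Q"
    proof (rule half)
      fix y assume y: "y \<in> ball x r"
      then have "y \<in> ball x R" using rR by auto
      then have "indicator (ball x r) y \<le> u y" "u y \<le> 1"
        using u unfolding cap_admissible_def by blast+
      then have "u y = 1" using y by simp
      then have "\<bar>u y - ereal a\<bar> = ereal \<bar>1 - a\<bar>" by (simp add: one_ereal_def)
      moreover have "1 / 2 \<le> \<bar>1 - a\<bar>" using False by linarith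
      ultimately show "ennreal (1 / 2) \<le> e2ennreal \<bar>u y - ereal a\<bar>"
        by (simp only: e2ennreal_ereal ennreal_leI)
    qed (use sets rR in \<open>auto intro: subset_ball\<close>)
    have "min ((\<gamma> - 1) / 2) (1 / (2 * D)) * m \<le> 1 / (2 * D) * m"
      using m by (intro mult_right_mono min.cobounded2) simp
    moreover have "1 / (2 * D) * m \<le> 1 / 2 * measure \<mu> (ball x r)"
      using D unfolding m_def by (simp add: field_simps)
    ultimately have "min ((\<gamma> - 1) / 2) (1 / (2 * D)) * m \<le> 1 / 2 * measure \<mu> (ball x r)"
      by linarith
    then have "ennreal (min ((\<gamma> - 1) / 2) (1 / (2 * D)) * m) \<le> ennreal (1 / 2 * measure \<mu> (ball x r))"
      by (rule ennreal_leI)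
    then show ?thesis unfolding m_def using Q by (rule order_trans)
  qed
qed

text \<open>Up to the factor 2^(-p), this is the bound I^p M^(1-p) that Hoelder's inequality would
  give.\<close>

lemma energy_lower_bound:
  assumes p: "1 \<le> p" and A: "A \<in> sets \<mu>" "emeasure \<mu> A \<le> ennreal M" and I: "0 < I" "0 < M"
    and g: "g \<in> borel_measurable \<mu>" "ennreal I \<le> (\<integral>\<^sup>+y\<in>A. g y \<partial>\<mu>)"
  shows "ennreal ((I / (2 * M)) powr (p - 1) * (I / 2)) \<le> (\<integral>\<^sup>+y\<in>A. epowr (g y) p \<partial>\<mu>)" (is "_ \<le> ?E")
proof -
  \<comment> \<open>With this level the additive error \<open>s * M\<close> absorbs exactly half of
    \<open>I\<close>.\<close>
  define s where "s = I / (2 * M)"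
  have s: "0 < s" "s * M = I / 2" using I by (auto simp: s_def)
  note [measurable] = A(1) g(1)
  have "ennreal I \<le> (\<integral>\<^sup>+y\<in>A. g y \<partial>\<mu>)" by (rule g(2))
  also have "\<dots> \<le> (\<integral>\<^sup>+y. ennreal (s powr (1 - p)) * (epowr (g y) p * indicator A y) + ennreal s * indicator A y \<partial>\<mu>)"
    using le_powr_mult_epowr_add[OF p s(1)] by (intro nn_integral_mono) (auto simp: indicator_def)
  also have "\<dots> = ennreal (s powr (1 - p)) * ?E + ennreal s * emeasure \<mu> A"
    by (subst nn_integral_add) (auto simp: nn_integral_cmult nn_integral_cmult_indicator)
  also have "ennreal s * emeasure \<mu> A \<le> ennreal s * ennreal M"
    using A(2) by (rule mult_left_mono) simp
  also have "ennreal s * ennreal M = ennreal (I / 2)"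
    using s I by (simp flip: ennreal_mult)
  finally have le: "ennreal I \<le> ennreal (s powr (1 - p)) * ?E + ennreal (I / 2)"
    by (simp add: add_left_mono)
  show ?thesis
  proof (cases ?E)
    case (real e)
    then have "ennreal I \<le> ennreal (s powr (1 - p) * e + I / 2)"
      using le I by (simp add: ennreal_mult)
    then have "I \<le> s powr (1 - p) * e + I / 2"
      using real I by (subst (asm) ennreal_le_iff) auto
    then have "I / 2 \<le> s powr (1 - p) * e" by simp
    then have "s powr (p - 1) * (I / 2) \<le> s powr (p - 1) * (s powr (1 - p) * e)"
      by (rule mult_left_mono) simp
    also have "\<dots> = e" using s(1) by (simp flip: mult.assoc powr_add)
    finally show ?thesis using real by (simp add: s_def ennreal_leI)
  qed simp
qed

theorem theorem4p3:
  fixes \<mu> :: "'a::metric_space measure" and x0 :: 'a and p \<tau> :: real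
  assumes "metric_measure_space \<mu>"
    and "1 \<le> p"
    and "poincare_1 \<mu> x0"
    and "annular_decay_1 \<mu> x0"
    and "1 < \<tau>"
    and "reverse_doubling \<mu> x0 \<tau>"
  shows "\<exists>C\<ge>1. \<forall>r R. 0 < R / 2 \<and> R / 2 \<le> r \<and> r < R \<and>
           ereal R \<le> ediameter (UNIV :: 'a set) / ereal (2 * \<tau>) \<longrightarrow>
         ennreal (1 / C * (1 - r / R) powr (1 - p) * (measure \<mu> (ball x0 R) / R powr p))
           \<le> variational_capacity \<mu> p (ball x0 r) (ball x0 R) \<and>
         variational_capacity \<mu> p (ball x0 r) (ball x0 R)
           \<le> ennreal (C * (1 - r / R) powr (1 - p) * (measure \<mu> (ball x0 R) / R powr p))"
proof -
  note \<mu> = assms(1) and p = assms(2) and \<tau> = assms(5)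
  have \<mu>b: "complete_borel_measure \<mu>" using \<mu> by (simp add: metric_measure_space_def)
  obtain C0 where C0: "measure \<mu> (ball x0 R - ball x0 r) \<le> C0 * (1 - r / R) * measure \<mu> (ball x0 R)"
    if "0 < r" "r < R" for r R
    using assms(4) unfolding annular_decay_1_def by blast
  \<comment> \<open>The decay constant is enlarged to at least 1, as the doubling argument
    requires.\<close>
  define A where "A = max 1 C0"
  have "1 \<le> A" by (simp add: A_def)
  have decay: "measure \<mu> (ball x0 R - ball x0 r) \<le> A * (1 - r / R) * measure \<mu> (ball x0 R)"
    if "0 < r" "r < R" for r R
  proof -
    have "C0 * (1 - r / R) * measure \<mu> (ball x0 R) \<le> A * (1 - r / R) * measure \<mu> (ball x0 R)"
      using that by (intro mult_right_mono) (auto simp: A_def)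
    then show ?thesis using C0[OF that] by simp
  qed
  obtain D where D: "1 \<le> D"
    "\<And>r R. 0 < R \<Longrightarrow> R / 2 \<le> r \<Longrightarrow> measure \<mu> (ball x0 R) \<le> D * measure \<mu> (ball x0 r)"
    using annular_decay_imp_doubling[OF \<mu> \<open>1 \<le> A\<close> decay] by blast
  obtain \<gamma> where \<gamma>: "1 < \<gamma>"
    "\<And>R. 0 < R \<Longrightarrow> ereal R \<le> ediameter (UNIV :: 'a set) / ereal (2 * \<tau>) \<Longrightarrow>
      \<gamma> * measure \<mu> (ball x0 R) \<le> measure \<mu> (ball x0 (\<tau> * R))"
    using assms(6) unfolding reverse_doubling_def by blast
  obtain K \<Lambda> where K: "0 < K" "1 \<le> \<Lambda>"
    and PI: "\<And>s f g. 0 < s \<Longrightarrow> ereal_integrable \<mu> f \<Longrightarrow> upper_gradient f g \<Longrightarrow>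
      (\<integral>\<^sup>+y\<in>ball x0 s. e2ennreal \<bar>f y - ereal (average \<mu> f (ball x0 s))\<bar> \<partial>\<mu>) / emeasure \<mu> (ball x0 s)
       \<le> ennreal (K * s) * ((\<integral>\<^sup>+y\<in>ball x0 (\<Lambda> * s). g y \<partial>\<mu>) / emeasure \<mu> (ball x0 (\<Lambda> * s)))"
    using assms(3) unfolding poincare_1_def by blast
  \<comment> \<open>The fraction of the measure of the ball of radius \<open>R\<close> that
    \<open>cap_admissible_oscillation\<close> guarantees.\<close>
  define c where "c = min ((\<gamma> - 1) / 2) (1 / (2 * D))"
  have c: "0 < c" using \<gamma>(1) D(1) by (simp add: c_def)
  \<comment> \<open>Fitted to \<open>energy_lower_bound\<close> with
    \<open>I = c * m / (K * \<tau> * R)\<close> and \<open>M = A * q * m\<close>, where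
    \<open>q = 1 - r / R\<close> and \<open>m\<close> is the measure of the ball of radius
    \<open>R\<close>: the level \<open>I / (2 * M)\<close> becomes \<open>\<kappa> / (R * q)\<close>
    and \<open>I / 2\<close> becomes \<open>\<kappa> * A * m / R\<close>. Their combination leaves
    the constant \<open>L\<close>.\<close>
  define \<kappa> where "\<kappa> = c / (2 * K * \<tau> * A)"
  have \<kappa>: "0 < \<kappa>" using c K \<tau> \<open>1 \<le> A\<close> by (simp add: \<kappa>_def)
  define L where "L = \<kappa> powr p * A"
  have L: "0 < L" using \<kappa> \<open>1 \<le> A\<close> by (simp add: L_def)
  \<comment> \<open>\<open>A\<close> serves the upper bound and \<open>1 / L\<close> the lower
    one.\<close>
  define C where "C = max A (1 / L)"
  have C: "1 \<le> C" "A \<le> C" "1 / C \<le> L"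
  proof -
    show "1 \<le> C" "A \<le> C" using \<open>1 \<le> A\<close> by (auto simp: C_def)
    have "1 / L \<le> C" by (simp add: C_def)
    then show "1 / C \<le> L" using L \<open>1 \<le> C\<close> by (simp add: field_simps)
  qed
  have "ennreal (1 / C * (1 - r / R) powr (1 - p) * (measure \<mu> (ball x0 R) / R powr p))
           \<le> variational_capacity \<mu> p (ball x0 r) (ball x0 R) \<and>
         variational_capacity \<mu> p (ball x0 r) (ball x0 R)
           \<le> ennreal (C * (1 - r / R) powr (1 - p) * (measure \<mu> (ball x0 R) / R powr p))"
    if rR: "0 < R / 2" "R / 2 \<le> r" "r < R"
      and diam: "ereal R \<le> ediameter (UNIV :: 'a set) / ereal (2 * \<tau>)" for r R
  proof
    have pos: "0 < R" "0 < r" using rR by auto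
    define q where "q = 1 - r / R"
    have q: "0 < q" "R - r = R * q" using rR pos by (auto simp: q_def field_simps)
    define m where "m = measure \<mu> (ball x0 R)"
    have m: "0 < m" using metric_measure_space_ball(2)[OF \<mu> pos(1)] by (simp add: m_def)
    let ?S = "q powr (1 - p) * (m / R powr p)"
    have S: "0 \<le> ?S" using m by simp
    have dec: "measure \<mu> (ball x0 R - ball x0 r) \<le> A * q * m"
      using decay[OF pos(2) rR(3)] by (simp add: q_def m_def)
    have "variational_capacity \<mu> p (ball x0 r) (ball x0 R)
        \<le> ennreal ((1 / (R - r)) powr p * measure \<mu> (ball x0 R - ball x0 r))"
      using variational_capacity_ball_le[OF \<mu> p pos(2) rR(3)] .
    also have "(1 / (R - r)) powr p * measure \<mu> (ball x0 R - ball x0 r) \<le> (1 / (R - r)) powr p * (A * q * m)"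
      using dec by (rule mult_left_mono) simp
    then have "ennreal ((1 / (R - r)) powr p * measure \<mu> (ball x0 R - ball x0 r))
        \<le> ennreal ((1 / (R - r)) powr p * (A * q * m))" by (rule ennreal_leI)
    \<comment> \<open>As \<open>R - r = R * q\<close>, the factor \<open>q\<close> from annular
      decay turns \<open>q powr (- p)\<close> into \<open>q powr (1 - p)\<close>.\<close>
    also have "(1 / (R - r)) powr p * (A * q * m) = A * ?S"
      using pos q by (simp add: powr_divide powr_mult powr_diff mult_ac)
    also have "ennreal (A * ?S) \<le> ennreal (C * ?S)"
      using C(2) S by (intro ennreal_leI mult_right_mono)
    finally show "variational_capacity \<mu> p (ball x0 r) (ball x0 R)
           \<le> ennreal (C * (1 - r / R) powr (1 - p) * (measure \<mu> (ball x0 R) / R powr p))"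
      by (simp add: q_def m_def mult.assoc)
    \<comment> \<open>On the ball of this radius reverse doubling leaves room outside the ball of
      radius \<open>R\<close>, where \<open>u\<close> vanishes.\<close>
    define T where "T = \<tau> * R"
    have T: "0 < T" "R \<le> T" using \<tau> pos by (auto simp: T_def)
    have "ennreal (1 / C * ?S) \<le> (\<integral>\<^sup>+y\<in>ball x0 R. epowr (g y) p \<partial>\<mu>)"
      if u: "cap_admissible \<mu> p (ball x0 r) (ball x0 R) u" and g: "minimal_weak_upper_gradient \<mu> p u g" for u g
    proof -
      have g': "weak_upper_gradient \<mu> p u g" "Lp_nonneg \<mu> p g" "g \<in> borel_measurable \<mu>"
        using g by (auto simp: minimal_weak_upper_gradient_def Lp_nonneg_def)
      let ?A = "ball x0 R - ball x0 r"
      have "ennreal (c * m) \<le> (\<integral>\<^sup>+y\<in>ball x0 T. e2ennreal \<bar>u y - ereal (average \<mu> u (ball x0 T))\<bar> \<partial>\<mu>)"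
        unfolding c_def m_def
        by (rule cap_admissible_oscillation[OF \<mu> pos(2) rR(3) T(2) u _ D(1) D(2)[OF pos(1) rR(2)]])
          (use \<gamma>(2)[OF pos(1) diam] in \<open>simp add: T_def\<close>)
      also have "\<dots> \<le> ennreal (K * T) * (\<integral>\<^sup>+y\<in>?A. g y \<partial>\<mu>)"
        by (rule poincare_test_function[OF \<mu> p PI[OF T(1)] T(1) K(2) pos(2) rR(3) u g'(1,2)])
      finally have le: "ennreal (c * m) \<le> ennreal (K * T) * (\<integral>\<^sup>+y\<in>?A. g y \<partial>\<mu>)" .
      have KT: "0 < K * T" using K T by simp
      have I_le: "ennreal (c * m / (K * T)) \<le> (\<integral>\<^sup>+y\<in>?A. g y \<partial>\<mu>)"
      \<comment> \<open>Division by \<open>K * T\<close> is carried out in the reals; an infinite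
        integral makes the bound trivial.\<close>
      proof (cases "\<integral>\<^sup>+y\<in>?A. g y \<partial>\<mu>")
        case (real e)
        then have "ennreal (c * m) \<le> ennreal (K * T * e)" using le KT by (simp add: ennreal_mult)
        then have "c * m \<le> K * T * e" using real KT by (subst (asm) ennreal_le_iff) auto
        then have "c * m / (K * T) \<le> e" using KT by (simp add: divide_le_eq mult.commute)
        then show ?thesis using real by (simp add: ennreal_leI)
      qed simp
      have Asets: "?A \<in> sets \<mu>"
        using complete_borel_measure_sets[OF \<mu>b borel_open[OF open_ball]] by blast
      have Ale: "emeasure \<mu> ?A \<le> ennreal (A * q * m)"
        using emeasure_ball_diff[OF \<mu> pos(1), of x0 r] dec by (simp add: ennreal_leI)
      have M: "0 < A * q * m" using \<open>1 \<le> A\<close> q m by simp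
      have I: "0 < c * m / (K * T)" using c m KT by simp
      have "ennreal ((c * m / (K * T) / (2 * (A * q * m))) powr (p - 1) * (c * m / (K * T) / 2))
          \<le> (\<integral>\<^sup>+y\<in>?A. epowr (g y) p \<partial>\<mu>)"
        by (rule energy_lower_bound[OF p Asets Ale I M g'(3) I_le])
      also have "c * m / (K * T) / (2 * (A * q * m)) = \<kappa> / (R * q)"
        using m by (simp add: \<kappa>_def T_def field_simps)
      also have "c * m / (K * T) / 2 = \<kappa> * A * m / R"
        using \<open>1 \<le> A\<close> by (simp add: \<kappa>_def T_def field_simps)
      also have "(\<kappa> / (R * q)) powr (p - 1) * (\<kappa> * A * m / R) = L * ?S"
        using \<kappa> pos q by (simp add: L_def powr_divide powr_mult powr_diff mult_ac)
      also have "(\<integral>\<^sup>+y\<in>?A. epowr (g y) p \<partial>\<mu>) \<le> (\<integral>\<^sup>+y\<in>ball x0 R. epowr (g y) p \<partial>\<mu>)"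
        by (rule set_nn_integral_mono_set) auto
      finally have "ennreal (L * ?S) \<le> (\<integral>\<^sup>+y\<in>ball x0 R. epowr (g y) p \<partial>\<mu>)" .
      moreover have "ennreal (1 / C * ?S) \<le> ennreal (L * ?S)"
        using C(3) S by (intro ennreal_leI mult_right_mono)
      ultimately show ?thesis by (rule order_trans[rotated])
    qed
    then have "ennreal (1 / C * ?S) \<le> variational_capacity \<mu> p (ball x0 r) (ball x0 R)"
      unfolding variational_capacity_def by (intro INF_greatest) auto
    then show "ennreal (1 / C * (1 - r / R) powr (1 - p) * (measure \<mu> (ball x0 R) / R powr p))
           \<le> variational_capacity \<mu> p (ball x0 r) (ball x0 R)"
      by (simp add: q_def m_def mult.assoc)
  qed
  with C(1) show ?thesis by blast
qed

end
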